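(* Let $N=n_1+\cdots+n_k$ and view $\{0,1\}^N=\{0,1\}^{n_1}\times\cdots\times\{0,1\}^{n_k}$. For any nonempty $k$-wise grid $S=S_1\times\cdots\times S_k\subseteq\{0,1\}^N$ (each $S_i\subseteq\{0,1\}^{n_i}$ symmetric) and $t\ge1$, we have \[ \mathrm{EHC}_N^{(t,t-1)}(\{0,1\}^N\setminus S)=\mathrm{EPC}_N^{(t,t-1)}(\{0,1\}^N\setminus S)=\sum_{i=1}^k \overline{\Lambda}_{n_i}(S_i)+2t-2. \]
   Context: Work over $\mathbb R$. A polynomial $P$ has multiplicity at least $t$ at $a$ if all partial derivatives of $P$ of order less than $t$ vanish at $a$; $\mathrm{mult}(P,a)$ is the largest such $t$. For $T\subsetneq\{0,1\}^N$, $t\ge1$, $\ell\in[0,t-1]$: a $(t,\ell)$-exact hyperplane cover of $T$ is a finite multiset of affine hyperplanes in $\mathbb R^N$ such that every point of $T$ lies in at least $t$ of them and every point of $\{0,1\}^N\setminus T$ lies in exactly $\ell$ of them (counted with multiplicity); a $(t,\ell)$-exact polynomial cover of $T$ is a nonzero polynomial $P$ with $\mathrm{mult}(P,a)\ge t$ for $a\in T$ and $\mathrm{mult}(P,b)=\ell$ for $b\in\{0,1\}^N\setminus T$. $\mathrm{EHC}_N^{(t,\ell)}(T)$ is the minimum size of such a hyperplane cover and $\mathrm{EPC}_N^{(t,\ell)}(T)$ the minimum degree of such a polynomial cover. A set $S\subseteq\{0,1\}^n$ is symmetric if closed under permutations of coordinates; $W_n(S)=\{|x|:x\in S\}$ ($|x|$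 the Hamming weight). For $i\in[0,n]$, $W_{n,i}=[0,i-1]\cup[n-i+1,n]$ (integer intervals). $\mu_n(S)=\max\{i\in[0,\lceil n/2\rceil]:W_{n,i}\subseteq W_n(S)\}$, $\Lambda_n(S)=|W_n(S)|-\mu_n(S)$, $\overline{\Lambda}_n(S)=\Lambda_n(\{0,1\}^n\setminus S)$. *)

theory Defs
  imports
    Complex_Main
    "HOL-Library.Multiset"
    "HOL-Library.Poly_Mapping"
    "HOL-Library.Extended_Nat"
    "HOL-Combinatorics.Permutations"
begin

text \<open>
  Points of \<open>\<real>\<^sup>N\<close> are real lists of length \<open>N\<close> (coordinates indexed by \<open>0, ..., N-1\<close>), so that
  the identification of \<open>{0,1}\<^sup>N\<close> with a product of smaller cubes is list concatenation.
\<close>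

definition cube :: "nat \<Rightarrow> real list set" where
  "cube n = {x. length x = n \<and> set x \<subseteq> {0, 1}}"

definition hamming_weight :: "real list \<Rightarrow> nat" where
  "hamming_weight x = card {i. i < length x \<and> x ! i = 1}"

definition symmetric_set :: "nat \<Rightarrow> real list set \<Rightarrow> bool" where
  "symmetric_set n S \<longleftrightarrow>
     S \<subseteq> cube n \<and> (\<forall>x\<in>S. \<forall>\<pi>. \<pi> permutes {..<n} \<longrightarrow> permute_list \<pi> x \<in> S)"

definition grid :: "nat \<Rightarrow> (nat \<Rightarrow> real list set) \<Rightarrow> real list set" where
  "grid k S = {concat (map x [0..<k]) | x. \<forall>i<k. x i \<in> S i}"


definition affine_hyperplane :: "nat \<Rightarrow> real list set \<Rightarrow> bool" where
  "affine_hyperplane N h \<longleftrightarrow>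
     (\<exists>(a :: nat \<Rightarrow> real) b. (\<exists>i<N. a i \<noteq> 0) \<and>
        h = {x. length x = N \<and> (\<Sum>i<N. a i * x ! i) = b})"

definition exact_hyperplane_cover ::
  "nat \<Rightarrow> nat \<Rightarrow> nat \<Rightarrow> real list set \<Rightarrow> real list set multiset \<Rightarrow> bool" where
  "exact_hyperplane_cover N t l T H \<longleftrightarrow>
     (\<forall>h\<in>#H. affine_hyperplane N h) \<and>
     (\<forall>x\<in>T. size {#h \<in># H. x \<in> h#} \<ge> t) \<and>
     (\<forall>x\<in>cube N - T. size {#h \<in># H. x \<in> h#} = l)"

text \<open>
  A polynomial maps each monomial, given by its finitely supported exponent vector, to its
  coefficient; variables are indexed by natural numbers.
\<close>

type_synonym real_mpoly = "(nat \<Rightarrow>\<^sub>0 nat) \<Rightarrow>\<^sub>0 real"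

definition poly_in_vars :: "nat \<Rightarrow> real_mpoly \<Rightarrow> bool" where
  "poly_in_vars N P \<longleftrightarrow> (\<forall>m\<in>Poly_Mapping.keys P. Poly_Mapping.keys m \<subseteq> {..<N})"

definition total_degree :: "real_mpoly \<Rightarrow> nat" where
  "total_degree P =
     Max (insert 0 ((\<lambda>m. \<Sum>i\<in>Poly_Mapping.keys m. Poly_Mapping.lookup m i) ` Poly_Mapping.keys P))"

definition eval_at :: "real_mpoly \<Rightarrow> real list \<Rightarrow> real" where
  "eval_at P x =
     (\<Sum>m\<in>Poly_Mapping.keys P.
        Poly_Mapping.lookup P m * (\<Prod>i\<in>Poly_Mapping.keys m. x ! i ^ Poly_Mapping.lookup m i))"

text \<open>
  Formal derivative in the variable \<open>i\<close>. Monomials not containing that variable contribute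
  coefficient \<open>0\<close>, so the truncated subtraction of exponents does no harm.
\<close>

definition partial_deriv :: "nat \<Rightarrow> real_mpoly \<Rightarrow> real_mpoly" where
  "partial_deriv i P =
     (\<Sum>m\<in>Poly_Mapping.keys P.
        Poly_Mapping.single (m - Poly_Mapping.single i 1)
          (of_nat (Poly_Mapping.lookup m i) * Poly_Mapping.lookup P m))"

text \<open>The list \<open>is\<close> names the variables of an iterated partial derivative of order \<open>length is\<close>.\<close>

definition mult_at_least :: "nat \<Rightarrow> real_mpoly \<Rightarrow> real list \<Rightarrow> nat \<Rightarrow> bool" where
  "mult_at_least N P a t \<longleftrightarrow>
     (\<forall>is. set is \<subseteq> {..<N} \<and> length is < t \<longrightarrow> eval_at (fold partial_deriv is P) a = 0)"

text \<open>Meaningful only for nonzero \<open>P\<close>; for \<open>P = 0\<close> there is no largest \<open>t\<close>.\<close>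

definition mult_at :: "nat \<Rightarrow> real_mpoly \<Rightarrow> real list \<Rightarrow> nat" where
  "mult_at N P a = (GREATEST t. mult_at_least N P a t)"

definition exact_polynomial_cover ::
  "nat \<Rightarrow> nat \<Rightarrow> nat \<Rightarrow> real list set \<Rightarrow> real_mpoly \<Rightarrow> bool" where
  "exact_polynomial_cover N t l T P \<longleftrightarrow>
     poly_in_vars N P \<and> P \<noteq> 0 \<and>
     (\<forall>a\<in>T. mult_at N P a \<ge> t) \<and>
     (\<forall>b\<in>cube N - T. mult_at N P b = l)"

text \<open>
  The minima are taken in \<^typ>\<open>enat\<close>, where the infimum of the empty set is \<open>\<infinity>\<close>: a finite value
  of \<open>EHC\<close> or \<open>EPC\<close> therefore includes the existence of a cover attaining it.
\<close>

definition EHC :: "nat \<Rightarrow> nat \<Rightarrow> nat \<Rightarrow> real list set \<Rightarrow> enat" where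
  "EHC N t l T = (INF H \<in> {H. exact_hyperplane_cover N t l T H}. enat (size H))"

definition EPC :: "nat \<Rightarrow> nat \<Rightarrow> nat \<Rightarrow> real list set \<Rightarrow> enat" where
  "EPC N t l T = (INF P \<in> {P. exact_polynomial_cover N t l T P}. enat (total_degree P))"


definition weight_set :: "real list set \<Rightarrow> nat set" where
  "weight_set S = hamming_weight ` S"

text \<open>\<open>{..<i}\<close> is the integer interval \<open>[0, i - 1]\<close>, empty for \<open>i = 0\<close>.\<close>

definition outer_weights :: "nat \<Rightarrow> nat \<Rightarrow> nat set" where
  "outer_weights n i = {..<i} \<union> {n - i + 1..n}"

definition mu :: "nat \<Rightarrow> real list set \<Rightarrow> nat" where
  "mu n S = Max {i. i \<le> nat \<lceil>real n / 2\<rceil> \<and> outer_weights n i \<subseteq> weight_set S}"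

text \<open>The subtraction on \<^typ>\<open>nat\<close> does not truncate, see \<open>mu_le_card\<close> below.\<close>

definition Lambda :: "nat \<Rightarrow> real list set \<Rightarrow> nat" where
  "Lambda n S = card (weight_set S) - mu n S"

definition Lambda_bar :: "nat \<Rightarrow> real list set \<Rightarrow> nat" where
  "Lambda_bar n S = Lambda n (cube n - S)"

lemma finite_cube: "finite (cube n)"
proof -
  have "cube n = {x. set x \<subseteq> {0, 1} \<and> length x = n}"
    by (auto simp: cube_def)
  then show ?thesis
    using finite_lists_length_eq[of "{0, 1 :: real}" n] by simp
qed

lemma mu_le_card:
  assumes "S \<subseteq> cube n"
  shows "mu n S \<le> card (weight_set S)"
proof -
  let ?A = "{i. i \<le> nat \<lceil>real n / 2\<rceil> \<and> outer_weights n i \<subseteq> weight_set S}"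
  have "finite ?A" by (rule finite_subset[of _ "{..nat \<lceil>real n / 2\<rceil>}"]) auto
  moreover have "0 \<in> ?A" by (simp add: outer_weights_def)
  ultimately have "mu n S \<in> ?A" unfolding mu_def by (intro Max_in) auto
  then have "{..<mu n S} \<subseteq> weight_set S" by (auto simp: outer_weights_def)
  moreover have "finite (weight_set S)"
    using finite_subset[OF assms finite_cube] by (simp add: weight_set_def)
  ultimately have "card {..<mu n S} \<le> card (weight_set S)" by (intro card_mono)
  then show ?thesis by simp
qed

end

theory Submission
  imports Defs "HOL-Computational_Algebra.Polynomial"
begin

text \<open>
  The chain is \<open>value \<le> EPC \<le> EHC \<le> value\<close>. The middle inequality takes the product of the
  linear forms of a hyperplane cover; its multiplicity at a point is read off along a line that
  is transversal to all the hyperplanes.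

  Lower bound: expand a cover \<open>P\<close> as \<open>\<Sum>\<^sub>\<gamma> R\<^sub>\<gamma>(x) \<Prod>\<^sub>i (x\<^sub>i(x\<^sub>i - 1))^\<gamma>\<^sub>i\<close> with multilinear
  \<open>R\<^sub>\<gamma>\<close>. Multiplicity \<open>t - 1\<close> on the whole cube forces \<open>|\<gamma>| \<ge> t - 1\<close>, and then \<open>P\<close> has multiplicity
  at least \<open>t\<close> at a point of the cube iff all \<open>R\<^sub>\<gamma>\<close> with \<open>|\<gamma>| = t - 1\<close> vanish there. Hence some
  \<open>R\<^sub>\<gamma>\<close> of degree at most \<open>deg P - 2(t - 1)\<close> vanishes off the grid, but not at a prescribed point
  \<open>y\<close> of the grid. Multiplied by few linear factors it becomes a multiple of the indicator
  function of \<open>y\<close> on a subcube, and such a function has degree at least the dimension.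

  Upper bound: in every block take the hyperplanes \<open>|x| = w\<close> for the isolated weights \<open>w\<close> to be
  covered, and \<open>\<mu>\<close> further hyperplanes that cover exactly the \<open>2\<mu>\<close> outer weights; add \<open>t - 1\<close>
  copies of \<open>x\<^sub>0 = 0\<close> and of \<open>x\<^sub>0 = 1\<close>.
\<close>

section \<open>Real multivariate polynomials\<close>

abbreviation mconst :: "real \<Rightarrow> real_mpoly" where
  "mconst c \<equiv> Poly_Mapping.single 0 c"

abbreviation mvar :: "nat \<Rightarrow> real_mpoly" where
  "mvar i \<equiv> Poly_Mapping.single (Poly_Mapping.single i 1) 1"

definition exp_degree :: "(nat \<Rightarrow>\<^sub>0 nat) \<Rightarrow> nat" where
  "exp_degree m = (\<Sum>i\<in>Poly_Mapping.keys m. Poly_Mapping.lookup m i)"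

definition exp_eval :: "(nat \<Rightarrow> real) \<Rightarrow> (nat \<Rightarrow>\<^sub>0 nat) \<Rightarrow> real" where
  "exp_eval x m = (\<Prod>i\<in>Poly_Mapping.keys m. x i ^ Poly_Mapping.lookup m i)"

definition poly_eval :: "(nat \<Rightarrow> real) \<Rightarrow> real_mpoly \<Rightarrow> real" where
  "poly_eval x P = (\<Sum>m\<in>Poly_Mapping.keys P. Poly_Mapping.lookup P m * exp_eval x m)"

lemma eval_at_eq: "eval_at P x = poly_eval ((!) x) P"
  by (simp add: eval_at_def poly_eval_def exp_eval_def)

lemma exp_degree_superset:
  "finite A \<Longrightarrow> Poly_Mapping.keys m \<subseteq> A \<Longrightarrow> exp_degree m = (\<Sum>i\<in>A. Poly_Mapping.lookup m i)"
  unfolding exp_degree_def by (rule sum.mono_neutral_left) (auto simp: in_keys_iff)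

lemma exp_eval_superset:
  "finite A \<Longrightarrow> Poly_Mapping.keys m \<subseteq> A \<Longrightarrow> exp_eval x m = (\<Prod>i\<in>A. x i ^ Poly_Mapping.lookup m i)"
  unfolding exp_eval_def by (rule prod.mono_neutral_left) (auto simp: in_keys_iff)

lemma exp_degree_add: "exp_degree (m + m') = exp_degree m + exp_degree m'"
proof -
  let ?A = "Poly_Mapping.keys m \<union> Poly_Mapping.keys m'"
  have "Poly_Mapping.keys (m + m') \<subseteq> ?A" by (rule Poly_Mapping.keys_add)
  then show ?thesis
    by (simp add: exp_degree_superset[of ?A] lookup_add sum.distrib)
qed

lemma exp_eval_add: "exp_eval x (m + m') = exp_eval x m * exp_eval x m'"
proof -
  let ?A = "Poly_Mapping.keys m \<union> Poly_Mapping.keys m'"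
  have "Poly_Mapping.keys (m + m') \<subseteq> ?A" by (rule Poly_Mapping.keys_add)
  then show ?thesis
    by (simp add: exp_eval_superset[of ?A] lookup_add power_add prod.distrib)
qed

lemma exp_degree_single [simp]: "exp_degree (Poly_Mapping.single i k) = k"
  by (cases "k = 0") (auto simp: exp_degree_def)

lemma exp_degree_0 [simp]: "exp_degree 0 = 0"
  by (simp add: exp_degree_def)

lemma exp_eval_0 [simp]: "exp_eval x 0 = 1"
  by (simp add: exp_eval_def)

lemma exp_eval_single [simp]: "exp_eval x (Poly_Mapping.single i k) = x i ^ k"
  by (cases "k = 0") (auto simp: exp_eval_def)

lemma exp_diff_single:
  fixes m :: "nat \<Rightarrow>\<^sub>0 nat"
  assumes "Poly_Mapping.lookup m i > 0"
  shows "(m - Poly_Mapping.single i 1) + Poly_Mapping.single i 1 = m"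
  by (rule poly_mapping_eqI)
    (use assms in \<open>auto simp: lookup_add lookup_minus lookup_single when_def\<close>)

lemma keys_exp_diff:
  "Poly_Mapping.keys ((m :: nat \<Rightarrow>\<^sub>0 nat) - m') \<subseteq> Poly_Mapping.keys m"
  by (auto simp: in_keys_iff lookup_minus)

text \<open>An exponent vector is built by raising one exponent at a time. Statements about
  monomials thus reduce to the effect of one more variable factor; the induction runs on the
  degree.\<close>

lemma exp_induct [consumes 1, case_names zero add]:
  fixes m :: "nat \<Rightarrow>\<^sub>0 nat"
  assumes "Poly_Mapping.keys m \<subseteq> A"
    and "Q 0"
    and "\<And>m i. Poly_Mapping.keys m \<subseteq> A \<Longrightarrow> i \<in> A \<Longrightarrow> Q m \<Longrightarrow> Q (m + Poly_Mapping.single i 1)"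
  shows "Q m"
  using assms(1)
proof (induction "exp_degree m" arbitrary: m)
  case 0
  then have "m = 0"
    by (auto simp: exp_degree_def in_keys_iff intro!: poly_mapping_eqI)
  then show ?case using assms(2) by simp
next
  case (Suc d)
  then obtain i where i: "i \<in> Poly_Mapping.keys m" "Poly_Mapping.lookup m i > 0"
    by (metis exp_degree_def sum.neutral gr0I nat.distinct(1))
  let ?m = "m - Poly_Mapping.single i 1"
  have m: "m = ?m + Poly_Mapping.single i 1"
    using exp_diff_single[OF i(2)] by simp
  have "Suc d = exp_degree ?m + 1"
    using Suc.hyps(2) exp_degree_add[of ?m "Poly_Mapping.single i 1"]
    unfolding m[symmetric] by simp
  moreover have "Poly_Mapping.keys ?m \<subseteq> A"
    using keys_exp_diff Suc.prems by blast
  ultimately have "Q ?m" using Suc.hyps(1) by simp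
  moreover have "i \<in> A" using i Suc.prems by blast
  ultimately have "Q (?m + Poly_Mapping.single i 1)"
    using assms(3) \<open>Poly_Mapping.keys ?m \<subseteq> A\<close> by blast
  then show ?case unfolding m[symmetric] .
qed

text \<open>Reduces additive statements to single terms. The \<open>single\<close> case concerns
  only monomials of \<open>P\<close> with their own coefficients, so facts about \<open>P\<close>
  itself, such as \<open>poly_in_vars\<close>, can be used there.\<close>

lemma mpoly_sum_induct [case_names single zero add]:
  fixes P :: "'a \<Rightarrow>\<^sub>0 'b::comm_monoid_add"
  assumes "\<And>m. m \<in> Poly_Mapping.keys P \<Longrightarrow> Q (Poly_Mapping.single m (Poly_Mapping.lookup P m))"
    and "Q 0"
    and "\<And>R R'. Q R \<Longrightarrow> Q R' \<Longrightarrow> Q (R + R')"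
  shows "Q P"
proof -
  have "Q (\<Sum>m\<in>A. Poly_Mapping.single m (Poly_Mapping.lookup P m))"
    if "finite A" "A \<subseteq> Poly_Mapping.keys P" for A
    using that by (induction rule: finite_induct) (auto intro!: assms)
  moreover have "(\<Sum>m\<in>Poly_Mapping.keys P. Poly_Mapping.single m (Poly_Mapping.lookup P m)) = P"
    by (rule poly_mapping_eqI) (simp add: lookup_sum lookup_single when_def in_keys_iff sum.delta)
  ultimately show ?thesis by (metis finite_keys order_refl)
qed

lemma poly_eval_single [simp]: "poly_eval x (Poly_Mapping.single m c) = c * exp_eval x m"
  by (cases "c = 0") (auto simp: poly_eval_def)

lemma poly_eval_0 [simp]: "poly_eval x 0 = 0"
  by (simp add: poly_eval_def)

lemma poly_eval_add [simp]: "poly_eval x (P + Q) = poly_eval x P + poly_eval x Q"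
  unfolding poly_eval_def by (rule setsum_keys_plus_distrib) (auto simp: algebra_simps)

lemma poly_eval_mult [simp]: "poly_eval x (P * Q) = poly_eval x P * poly_eval x Q"
proof (induction P rule: mpoly_sum_induct)
  case (single m)
  show ?case
  proof (induction Q rule: mpoly_sum_induct)
    case (single m')
    then show ?case by (simp add: mult_single exp_eval_add)
  qed (auto simp: algebra_simps)
qed (auto simp: algebra_simps)

lemma poly_eval_1 [simp]: "poly_eval x 1 = 1"
  using poly_eval_single[of x 0 1] by simp

lemma poly_eval_diff [simp]: "poly_eval x (P - Q) = poly_eval x P - poly_eval x Q"
  using poly_eval_add[of x "P - Q" Q] by simp

lemma poly_eval_power [simp]: "poly_eval x (P ^ n) = poly_eval x P ^ n"
  by (induction n) auto

lemma poly_eval_sum [simp]: "poly_eval x (sum f A) = (\<Sum>a\<in>A. poly_eval x (f a))"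
  by (induction A rule: infinite_finite_induct) auto

lemma poly_eval_prod [simp]: "poly_eval x (prod f A) = (\<Prod>a\<in>A. poly_eval x (f a))"
  by (induction A rule: infinite_finite_induct) auto

section \<open>Formal partial derivatives\<close>

lemma partial_deriv_single [simp]:
  "partial_deriv i (Poly_Mapping.single m c) =
     Poly_Mapping.single (m - Poly_Mapping.single i 1) (of_nat (Poly_Mapping.lookup m i) * c)"
  by (cases "c = 0") (auto simp: partial_deriv_def)

lemma partial_deriv_0 [simp]: "partial_deriv i 0 = 0"
  by (simp add: partial_deriv_def)

lemma partial_deriv_add [simp]: "partial_deriv i (P + Q) = partial_deriv i P + partial_deriv i Q"
  unfolding partial_deriv_def
  by (rule setsum_keys_plus_distrib) (auto simp: algebra_simps single_add)

lemma partial_deriv_mult: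
  "partial_deriv i (P * Q) = partial_deriv i P * Q + P * partial_deriv i Q"
proof (induction P rule: mpoly_sum_induct)
  case (single m)
  show ?case
  proof (induction Q rule: mpoly_sum_induct)
    case (single m')
    let ?e = "Poly_Mapping.single i (1::nat)"
    have 1: "(m - ?e) + m' = m + m' - ?e" if "Poly_Mapping.lookup m i > 0" for m m' :: "nat \<Rightarrow>\<^sub>0 nat"
      by (rule poly_mapping_eqI)
        (use that in \<open>auto simp: lookup_add lookup_minus lookup_single when_def\<close>)
    \<comment> \<open>With exponent 0 the truncated subtraction invalidates the identity of
      monomials in \<open>1\<close>, but then the coefficient is 0 on both sides.\<close>
    have 2: "Poly_Mapping.single ((m - ?e) + m') (real (Poly_Mapping.lookup m i) * c)
        = Poly_Mapping.single (m + m' - ?e) (real (Poly_Mapping.lookup m i) * c)" for m m' c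
      using 1[of m m'] by (cases "Poly_Mapping.lookup m i = 0") auto
    let ?c = "Poly_Mapping.lookup P m" and ?d = "Poly_Mapping.lookup Q m'"
    have A: "Poly_Mapping.single ((m - ?e) + m') (real (Poly_Mapping.lookup m i) * ?c * ?d)
        = Poly_Mapping.single (m + m' - ?e) (real (Poly_Mapping.lookup m i) * (?c * ?d))"
      using 2[of m m' "?c * ?d"] by (simp only: mult.assoc)
    have B: "Poly_Mapping.single (m + (m' - ?e)) (?c * (real (Poly_Mapping.lookup m' i) * ?d))
        = Poly_Mapping.single (m + m' - ?e) (real (Poly_Mapping.lookup m' i) * (?c * ?d))"
      using 2[of m' m "?c * ?d"] by (simp only: add.commute mult.left_commute)
    show ?case
      by (simp only: partial_deriv_single mult_single A B)
        (simp only: lookup_add of_nat_add distrib_right single_add)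
  qed (auto simp: algebra_simps)
qed (auto simp: algebra_simps)

text \<open>Lowering the exponent of variable \<open>i\<close> is injective on the monomials that
  contain it, so no two terms merge in the derivative.\<close>

lemma lookup_partial_deriv:
  "Poly_Mapping.lookup (partial_deriv i P) m =
     real (Suc (Poly_Mapping.lookup m i)) * Poly_Mapping.lookup P (m + Poly_Mapping.single i 1)"
proof (induction P rule: mpoly_sum_induct)
  case (single m')
  let ?e = "Poly_Mapping.single i (1::nat)"
  show ?case
  proof (cases "Poly_Mapping.lookup m' i = 0")
    case True
    then have "m + ?e \<noteq> m'"
      by (metis add_eq_0_iff_both_eq_0 lookup_add lookup_single_eq one_neq_zero)
    then show ?thesis using True by (auto simp: lookup_single when_def)
  next
    case False
    then have "(m' - ?e) + ?e = m'" using exp_diff_single[of m' i] by simp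
    moreover have "m + ?e - ?e = m" by simp
    ultimately have "m' - ?e = m \<longleftrightarrow> m' = m + ?e" by metis
    then show ?thesis
      by (cases "m' = m + ?e") (simp_all add: lookup_single lookup_add when_def)
  qed
qed (auto simp: lookup_add algebra_simps)

section \<open>Polynomials in the first N variables\<close>

lemma poly_in_vars_add: "poly_in_vars N P \<Longrightarrow> poly_in_vars N Q \<Longrightarrow> poly_in_vars N (P + Q)"
  using Poly_Mapping.keys_add[of P Q] by (auto simp: poly_in_vars_def)

lemma poly_in_vars_mult: "poly_in_vars N P \<Longrightarrow> poly_in_vars N Q \<Longrightarrow> poly_in_vars N (P * Q)"
  unfolding poly_in_vars_def by (blast dest: subsetD[OF keys_mult] subsetD[OF Poly_Mapping.keys_add])

lemma poly_in_vars_const [simp]: "poly_in_vars N (mconst c)"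
  by (cases "c = 0") (auto simp: poly_in_vars_def)

lemma poly_in_vars_0 [simp]: "poly_in_vars N 0"
  by (auto simp: poly_in_vars_def)

lemma poly_in_vars_var: "i < N \<Longrightarrow> poly_in_vars N (mvar i)"
  by (auto simp: poly_in_vars_def)

lemma poly_in_vars_sum: "(\<And>a. a \<in> A \<Longrightarrow> poly_in_vars N (f a)) \<Longrightarrow> poly_in_vars N (sum f A)"
  by (induction A rule: infinite_finite_induct) (auto intro: poly_in_vars_add)

lemma keys_partial_deriv:
  assumes "m \<in> Poly_Mapping.keys (partial_deriv i P)"
  shows "m + Poly_Mapping.single i 1 \<in> Poly_Mapping.keys P"
  using assms by (auto simp: in_keys_iff lookup_partial_deriv)

lemma poly_in_vars_partial_deriv:
  assumes "poly_in_vars N P"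
  shows "poly_in_vars N (partial_deriv i P)"
  unfolding poly_in_vars_def
proof
  fix m assume "m \<in> Poly_Mapping.keys (partial_deriv i P)"
  then have "Poly_Mapping.keys (m + Poly_Mapping.single i 1) \<subseteq> {..<N}"
    using assms keys_partial_deriv by (auto simp: poly_in_vars_def)
  moreover have "Poly_Mapping.keys m \<subseteq> Poly_Mapping.keys (m + Poly_Mapping.single i 1)"
    by (auto simp: in_keys_iff lookup_add)
  ultimately show "Poly_Mapping.keys m \<subseteq> {..<N}" by blast
qed

lemma poly_in_vars_induct [consumes 1, case_names const mult_var add]:
  assumes "poly_in_vars N P"
    and const: "\<And>c. Q (mconst c)"
    and mult: "\<And>P i. poly_in_vars N P \<Longrightarrow> i < N \<Longrightarrow> Q P \<Longrightarrow> Q (P * mvar i)"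
    and add: "\<And>P P'. Q P \<Longrightarrow> Q P' \<Longrightarrow> Q (P + P')"
  shows "Q P"
proof (induction P rule: mpoly_sum_induct)
  case (single m)
  then have "Poly_Mapping.keys m \<subseteq> {..<N}" using assms(1) by (auto simp: poly_in_vars_def)
  then have "Q (Poly_Mapping.single m c)" for c
  proof (induction m rule: exp_induct)
    case (add m i)
    then have "poly_in_vars N (Poly_Mapping.single m c)"
      by (auto simp: poly_in_vars_def)
    then show ?case
      using mult[OF _ _ add.IH] add by (simp add: mult_single)
  qed (rule const)
  then show ?case .
next
  case zero
  then show ?case using const[of 0] by simp
qed (rule add)

section \<open>Multiplicity\<close>

lemma mult_at_least_0 [simp]: "mult_at_least N P a 0"
  by (simp add: mult_at_least_def)

text \<open>\<open>fold\<close> applies the head of the list first, so the first derivative can be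
  peeled off. The later inductions on the order use this recursion instead of index lists.\<close>

lemma mult_at_least_Suc:
  "mult_at_least N P a (Suc t) \<longleftrightarrow>
     eval_at P a = 0 \<and> (\<forall>i<N. mult_at_least N (partial_deriv i P) a t)"
proof safe
  assume L: "mult_at_least N P a (Suc t)"
  show "eval_at P a = 0" using L[unfolded mult_at_least_def, rule_format, of "[]"] by simp
  show "mult_at_least N (partial_deriv i P) a t" if "i < N" for i
    unfolding mult_at_least_def
  proof safe
    fix js assume "set js \<subseteq> {..<N}" "length js < t"
    then show "eval_at (fold partial_deriv js (partial_deriv i P)) a = 0"
      using L[unfolded mult_at_least_def, rule_format, of "i # js"] that by simp
  qed
next
  assume R: "eval_at P a = 0" "\<forall>i<N. mult_at_least N (partial_deriv i P) a t"
  show "mult_at_least N P a (Suc t)"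
    unfolding mult_at_least_def
  proof safe
    fix js assume js: "set js \<subseteq> {..<N}" "length js < Suc t"
    show "eval_at (fold partial_deriv js P) a = 0"
    proof (cases js)
      case (Cons i ks)
      then have "i < N" "set ks \<subseteq> {..<N}" "length ks < t" using js by auto
      then show ?thesis
        using R(2)[rule_format, of i] Cons by (simp add: mult_at_least_def)
    qed (use R in simp)
  qed
qed

lemma mult_at_least_mono: "mult_at_least N P a t \<Longrightarrow> s \<le> t \<Longrightarrow> mult_at_least N P a s"
  by (auto simp: mult_at_least_def)

lemma mult_at_least_add:
  "mult_at_least N P a t \<Longrightarrow> mult_at_least N Q a t \<Longrightarrow> mult_at_least N (P + Q) a t"
  by (induction t arbitrary: P Q) (auto simp: mult_at_least_Suc eval_at_eq)

lemma mult_at_least_zero [simp]: "mult_at_least N 0 a t"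
  by (induction t) (auto simp: mult_at_least_Suc eval_at_eq)

lemma mult_at_least_sum:
  "(\<And>x. x \<in> A \<Longrightarrow> mult_at_least N (f x) a t) \<Longrightarrow> mult_at_least N (sum f A) a t"
  by (induction A rule: infinite_finite_induct) (auto intro: mult_at_least_add)

lemma mult_at_least_mult_right:
  "mult_at_least N P a t \<Longrightarrow> mult_at_least N (P * Q) a t"
proof (induction t arbitrary: P Q)
  case (Suc t)
  have "mult_at_least N P a t" using Suc.prems mult_at_least_mono[of N P a "Suc t" t] by simp
  with Suc show ?case
    by (auto simp: mult_at_least_Suc partial_deriv_mult eval_at_eq intro!: mult_at_least_add)
qed simp

text \<open>Leibniz rule: in one summand of the derivative \<open>P\<close> has lost an order and
  the induction hypothesis restores it, in the other \<open>P\<close> is intact and its multiplicity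
  suffices.\<close>

lemma mult_at_least_mult_Suc:
  assumes "eval_at Q a = 0"
  shows "mult_at_least N P a t \<Longrightarrow> mult_at_least N (P * Q) a (Suc t)"
proof (induction t arbitrary: P)
  case 0
  then show ?case using assms by (simp add: mult_at_least_Suc eval_at_eq)
next
  case (Suc t)
  then have "mult_at_least N (partial_deriv i P * Q) a (Suc t)" if "i < N" for i
    using that by (simp add: mult_at_least_Suc[of N P])
  moreover have "mult_at_least N (P * partial_deriv i Q) a (Suc t)" for i
    using Suc.prems by (rule mult_at_least_mult_right)
  ultimately show ?case
    using assms unfolding mult_at_least_Suc[of N "P * Q"]
    by (simp add: partial_deriv_mult mult_at_least_add eval_at_eq)
qed

lemma mult_at_least_mult_prod:
  assumes "finite I" "\<And>i. i \<in> I \<Longrightarrow> eval_at (f i) a = 0" "mult_at_least N P a t"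
  shows "mult_at_least N (P * (\<Prod>i\<in>I. f i ^ e i)) a (t + sum e I)"
proof -
  have pow: "mult_at_least N (P * f i ^ k) a (t + k)"
    if "mult_at_least N P a t" "i \<in> I" for P t i k
  proof (induction k)
    case (Suc k)
    show ?case
      using mult_at_least_mult_Suc[OF assms(2)[OF that(2)] Suc] by (simp add: ac_simps)
  qed (use that in simp)
  have "mult_at_least N (P * (\<Prod>i\<in>J. f i ^ e i)) a (t + sum e J)" if "J \<subseteq> I" for J
    using finite_subset[OF that assms(1)] that
  proof (induction J rule: finite_induct)
    case (insert j J)
    show ?case
      using pow[OF insert.IH, of j "e j"] insert by (simp add: ac_simps)
  qed (use assms in simp)
  then show ?thesis by simp
qed

text \<open>A nonzero polynomial can be differentiated down to a nonzero constant, so its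
  multiplicity is bounded. This is what makes \<open>GREATEST\<close> in \<open>mult_at\<close>
  meaningful. The induction is on a bound for the degree.\<close>

lemma ex_not_mult_at_least:
  assumes "poly_in_vars N P" "P \<noteq> 0"
  shows "\<exists>t. \<not> mult_at_least N P a t"
proof -
  define d where "d = Max (exp_degree ` Poly_Mapping.keys P)"
  then have "\<forall>m\<in>Poly_Mapping.keys P. exp_degree m \<le> d" by simp
  then show ?thesis using assms
  proof (induction d arbitrary: P)
    case 0
    have "Poly_Mapping.keys P \<subseteq> {0}"
    proof
      fix m assume "m \<in> Poly_Mapping.keys P"
      then have "exp_degree m = 0" using 0 by simp
      then have "m = 0" by (auto simp: exp_degree_def in_keys_iff intro!: poly_mapping_eqI)
      then show "m \<in> {0}" by simp
    qed
    then have "P = mconst (Poly_Mapping.lookup P 0)"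
      by (intro poly_mapping_eqI) (auto simp: lookup_single when_def in_keys_iff)
    then obtain c where "P = mconst c" "c \<noteq> 0" using 0 single_zero by metis
    then have "\<not> mult_at_least N P a (Suc 0)" by (simp add: mult_at_least_Suc eval_at_eq)
    then show ?case ..
  next
    case (Suc d)
    show ?case
    proof (cases "\<exists>i<N. partial_deriv i P \<noteq> 0")
      case True
      then obtain i where i: "i < N" "partial_deriv i P \<noteq> 0" by blast
      have "\<forall>m\<in>Poly_Mapping.keys (partial_deriv i P). exp_degree m \<le> d"
        using Suc.prems(1) keys_partial_deriv[of _ i P] exp_degree_add[of _ "Poly_Mapping.single i 1"]
        by fastforce
      then obtain t where "\<not> mult_at_least N (partial_deriv i P) a t"
        using Suc.IH i poly_in_vars_partial_deriv[OF Suc.prems(2)] by blast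
      then have "\<not> mult_at_least N P a (Suc t)" using i by (auto simp: mult_at_least_Suc)
      then show ?thesis ..
    next
      case False
      \<comment> \<open>If all derivatives vanish, \<open>P\<close> contains no variable, since the
        derivative in such a variable would keep a nonzero term. So the smaller bound holds for
        \<open>P\<close> itself.\<close>
      have "exp_degree m \<le> d" if "m \<in> Poly_Mapping.keys P" for m
      proof (cases "Poly_Mapping.keys m = {}")
        case False': False
        then obtain i where i: "i \<in> Poly_Mapping.keys m" by blast
        then have "i < N" using Suc.prems(2) that by (auto simp: poly_in_vars_def)
        then have "Poly_Mapping.lookup (partial_deriv i P) (m - Poly_Mapping.single i 1) = 0"
          using False by simp
        then have "Poly_Mapping.lookup P m = 0"
          using exp_diff_single[of m i] i by (auto simp: lookup_partial_deriv in_keys_iff)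
        then show ?thesis using that by (simp add: in_keys_iff)
      qed (simp add: exp_degree_def)
      then show ?thesis using Suc by blast
    qed
  qed
qed

text \<open>Boundedness ensures that the greatest value is attained; from here on
  \<open>mult_at\<close> is handled through \<open>mult_at_least\<close> alone.\<close>

lemma mult_at_ge_iff:
  assumes "poly_in_vars N P" "P \<noteq> 0"
  shows "t \<le> mult_at N P a \<longleftrightarrow> mult_at_least N P a t"
proof -
  obtain b where "\<not> mult_at_least N P a b" using ex_not_mult_at_least[OF assms] by blast
  then have bd: "\<And>s. mult_at_least N P a s \<Longrightarrow> s \<le> b"
    using mult_at_least_mono nat_le_linear by blast
  have "mult_at_least N P a (mult_at N P a)"
    unfolding mult_at_def by (rule GreatestI_nat[where k = 0 and b = b]) (use bd in auto)
  moreover have "s \<le> mult_at N P a" if "mult_at_least N P a s" for s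
    unfolding mult_at_def using that bd by (rule Greatest_le_nat)
  ultimately show ?thesis using mult_at_least_mono by blast
qed

section \<open>Multiplicity along lines\<close>

lemma DERIV_poly_eval_line:
  assumes "poly_in_vars N P"
  shows "((\<lambda>s. poly_eval (\<lambda>i. a i + s * v i) P) has_real_derivative
    (\<Sum>i<N. v i * poly_eval (\<lambda>i. a i + s * v i) (partial_deriv i P))) (at s)"
  using assms
proof (induction P rule: poly_in_vars_induct)
  case (const c)
  then show ?case by simp
next
  case (mult_var P j)
  have d: "v i * poly_eval x (partial_deriv i (P * mvar j)) =
      v i * poly_eval x (partial_deriv i P) * x j + (if i = j then v j * poly_eval x P else 0)" for i x
    by (cases "i = j")
      (simp_all add: partial_deriv_mult lookup_single_not_eq algebra_simps)
  have "((\<lambda>s. poly_eval (\<lambda>i. a i + s * v i) P * (a j + s * v j)) has_real_derivative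
     (\<Sum>i<N. v i * poly_eval (\<lambda>i. a i + s * v i) (partial_deriv i P)) * (a j + s * v j)
      + v j * poly_eval (\<lambda>i. a i + s * v i) P) (at s)"
    by (rule DERIV_mult[OF mult_var.IH]) (auto intro!: derivative_eq_intros)
  then show ?case
    using \<open>j < N\<close> unfolding d sum.distrib by (simp add: sum_distrib_right)
next
  case (add P P')
  show ?case
    using DERIV_add[OF add.IH] by (simp add: sum.distrib distrib_left)
qed

text \<open>Induction on the order: the derivative along the line combines partial derivatives that
  are already of order \<open>t\<close> in \<open>s\<close>, and the mean value theorem gains one
  more factor \<open>s\<close>. The base case is boundedness of a continuous function on
  [-1, 1].\<close>

lemma mult_at_least_line_bound:
  assumes "poly_in_vars N P" "mult_at_least N P a t"
  shows "\<exists>C. \<forall>s. \<bar>s\<bar> \<le> 1 \<longrightarrow> \<bar>poly_eval (\<lambda>i. a ! i + s * v i) P\<bar> \<le> C * \<bar>s\<bar> ^ t"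
  using assms
proof (induction t arbitrary: P)
  case 0
  have "\<exists>M. \<forall>s. - 1 \<le> s \<and> s \<le> 1 \<longrightarrow> \<bar>poly_eval (\<lambda>i. a ! i + s * v i) P\<bar> \<le> M"
    by (rule isCont_bounded)
      (auto intro!: continuous_rabs DERIV_isCont[OF DERIV_poly_eval_line[OF 0(1)]])
  then show ?case by (auto simp: abs_le_iff)
next
  case (Suc t)
  let ?f = "\<lambda>P s. poly_eval (\<lambda>i. a ! i + s * v i) P"
  let ?f' = "\<lambda>s. \<Sum>i<N. v i * ?f (partial_deriv i P) s"
  have "\<forall>i\<in>{..<N}. \<exists>C. \<forall>s. \<bar>s\<bar> \<le> 1 \<longrightarrow> \<bar>?f (partial_deriv i P) s\<bar> \<le> C * \<bar>s\<bar> ^ t"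
    using Suc by (auto simp: mult_at_least_Suc poly_in_vars_partial_deriv)
  then obtain C where C: "\<And>i s. i < N \<Longrightarrow> \<bar>s\<bar> \<le> 1 \<Longrightarrow> \<bar>?f (partial_deriv i P) s\<bar> \<le> C i * \<bar>s\<bar> ^ t"
    by (metis lessThan_iff)
  define D where "D = (\<Sum>i<N. \<bar>v i\<bar> * C i)"
  have D: "\<bar>?f' s\<bar> \<le> D * \<bar>s\<bar> ^ t" if "\<bar>s\<bar> \<le> 1" for s
  proof -
    have "\<bar>?f' s\<bar> \<le> (\<Sum>i<N. \<bar>v i\<bar> * \<bar>?f (partial_deriv i P) s\<bar>)"
      by (rule order_trans[OF sum_abs]) (simp add: abs_mult)
    also have "\<dots> \<le> (\<Sum>i<N. \<bar>v i\<bar> * (C i * \<bar>s\<bar> ^ t))"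
      by (intro sum_mono mult_left_mono C that) auto
    finally show ?thesis by (simp add: D_def sum_distrib_right mult.assoc)
  qed
  have "0 \<le> D" using D[of 1] by simp
  have f0: "?f P 0 = 0" using Suc.prems by (simp add: mult_at_least_Suc eval_at_eq)
  have "\<bar>?f P s\<bar> \<le> D * \<bar>s\<bar> ^ Suc t" if s: "\<bar>s\<bar> \<le> 1" for s
  proof -
    have "\<exists>z. \<bar>z\<bar> \<le> \<bar>s\<bar> \<and> ?f P s = s * ?f' z"
    proof (cases s "0 :: real" rule: linorder_cases)
      case less
      then obtain z where "s < z" "z < 0" "?f P 0 - ?f P s = (0 - s) * ?f' z"
        using MVT2[of s 0 "?f P" ?f'] DERIV_poly_eval_line[OF Suc.prems(1)] by blast
      then show ?thesis using f0 less by (intro exI[of _ z]) (simp add: algebra_simps)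
    next
      case equal
      then show ?thesis using f0 by auto
    next
      case greater
      then obtain z where "0 < z" "z < s" "?f P s - ?f P 0 = (s - 0) * ?f' z"
        using MVT2[of 0 s "?f P" ?f'] DERIV_poly_eval_line[OF Suc.prems(1)] by blast
      then show ?thesis using f0 by (intro exI[of _ z]) simp
    qed
    then obtain z where z: "\<bar>z\<bar> \<le> \<bar>s\<bar>" "?f P s = s * ?f' z" by blast
    have "\<bar>?f P s\<bar> = \<bar>s\<bar> * \<bar>?f' z\<bar>" using z(2) by (simp add: abs_mult)
    also have "\<dots> \<le> \<bar>s\<bar> * (D * \<bar>z\<bar> ^ t)"
      using D[of z] z(1) s by (intro mult_left_mono) auto
    also have "\<dots> \<le> \<bar>s\<bar> * (D * \<bar>s\<bar> ^ t)"
      using z(1) \<open>0 \<le> D\<close> by (intro mult_left_mono power_mono) auto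
    finally show ?thesis by (simp add: ac_simps)
  qed
  then show ?case by blast
qed

text \<open>Dividing by \<open>s ^ l\<close> leaves a function of size at most
  \<open>C * \<bar>s\<bar>\<close> near 0, whose limit is 0. Together with the bound along lines it
  turns multiplicity \<open>Suc l\<close> into the vanishing of the coefficient of
  \<open>s ^ l\<close>.\<close>

lemma leading_coeff_eq_0:
  fixes g :: "real \<Rightarrow> real"
  assumes "isCont g 0" "\<And>s. \<bar>s\<bar> \<le> 1 \<Longrightarrow> \<bar>s ^ l * g s\<bar> \<le> C * \<bar>s\<bar> ^ Suc l"
  shows "g 0 = 0"
proof -
  have bd: "\<bar>g s\<bar> \<le> C * \<bar>s\<bar>" if "\<bar>s\<bar> \<le> 1" "s \<noteq> 0" for s
  proof -
    have "\<bar>s\<bar> ^ l * \<bar>g s\<bar> \<le> \<bar>s\<bar> ^ l * (C * \<bar>s\<bar>)"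
      using assms(2)[OF that(1)] by (simp add: abs_mult power_abs ac_simps)
    then show ?thesis using that by simp
  qed
  have "(g \<longlongrightarrow> 0) (at 0)"
  proof (rule tendsto_0_le)
    show "((\<lambda>s. C * \<bar>s\<bar>) \<longlongrightarrow> 0) (at 0)"
      by (auto intro!: tendsto_eq_intros)
    have "\<forall>\<^sub>F s in at 0. norm (g s) \<le> C * \<bar>s\<bar>"
      unfolding eventually_at by (rule exI[of _ 1]) (auto intro!: bd)
    then show "\<forall>\<^sub>F s in at 0. norm (g s) \<le> norm (C * \<bar>s\<bar>) * 1"
      by (rule eventually_mono) simp
  qed
  moreover have "(g \<longlongrightarrow> g 0) (at 0)" using assms(1) by (simp add: isCont_def)
  ultimately show ?thesis using LIM_unique by blast
qed

section \<open>From hyperplane covers to polynomial covers\<close>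

lemma total_degree_le_iff:
  "total_degree P \<le> d \<longleftrightarrow> (\<forall>m\<in>Poly_Mapping.keys P. exp_degree m \<le> d)"
  by (auto simp: total_degree_def exp_degree_def)

lemma total_degree_add_le:
  "total_degree P \<le> d \<Longrightarrow> total_degree Q \<le> d \<Longrightarrow> total_degree (P + Q) \<le> d"
  unfolding total_degree_le_iff using Poly_Mapping.keys_add[of P Q] by blast

lemma total_degree_sum_le:
  "(\<And>a. a \<in> A \<Longrightarrow> total_degree (f a) \<le> d) \<Longrightarrow> total_degree (sum f A) \<le> d"
proof (induction A rule: infinite_finite_induct)
  case (insert a A)
  then show ?case by (simp add: total_degree_add_le)
qed (simp_all add: total_degree_def)

lemma total_degree_mult_le:
  assumes "total_degree P \<le> d" "total_degree Q \<le> e"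
  shows "total_degree (P * Q) \<le> d + e"
  unfolding total_degree_le_iff
proof
  fix m assume "m \<in> Poly_Mapping.keys (P * Q)"
  then obtain p q where "m = p + q" "p \<in> Poly_Mapping.keys P" "q \<in> Poly_Mapping.keys Q"
    using keys_mult[of P Q] by blast
  then show "exp_degree m \<le> d + e"
    using assms unfolding total_degree_le_iff by (simp add: exp_degree_add add_mono)
qed

lemma total_degree_single_le: "total_degree (Poly_Mapping.single m c) \<le> exp_degree m"
  unfolding total_degree_le_iff by (cases "c = 0") auto

definition affine_form :: "nat \<Rightarrow> (nat \<Rightarrow> real) \<Rightarrow> real \<Rightarrow> real_mpoly" where
  "affine_form N a b = (\<Sum>i<N. mconst (a i) * mvar i) + mconst (- b)"

lemma poly_eval_affine_form: "poly_eval x (affine_form N a b) = (\<Sum>i<N. a i * x i) - b"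
  by (simp add: affine_form_def)

lemma poly_in_vars_affine_form: "poly_in_vars N (affine_form N a b)"
  unfolding affine_form_def
  by (intro poly_in_vars_add poly_in_vars_sum poly_in_vars_mult poly_in_vars_const poly_in_vars_var) auto

lemma total_degree_affine_form: "total_degree (affine_form N a b) \<le> 1"
  unfolding affine_form_def
proof (intro total_degree_add_le total_degree_sum_le)
  show "total_degree (mconst (a i) * mvar i) \<le> 1" for i
    using total_degree_single_le[of "Poly_Mapping.single i 1" "a i"] by (simp add: mult_single)
  show "total_degree (mconst (- b)) \<le> 1"
    using total_degree_single_le[of 0 "- b"] by simp
qed

text \<open>The direction is taken on the moment curve, \<open>v i = r ^ i\<close>. Each condition
  then says that \<open>r\<close> is no root of a nonzero univariate polynomial, and finitely many
  such polynomials have finitely many roots.\<close>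

lemma ex_common_transversal:
  fixes a :: "'h \<Rightarrow> nat \<Rightarrow> real"
  assumes "finite A" "\<And>h. h \<in> A \<Longrightarrow> \<exists>i<N. a h i \<noteq> 0"
  shows "\<exists>v. \<forall>h\<in>A. (\<Sum>i<N. a h i * v i) \<noteq> 0"
proof -
  define p where "p h = (\<Sum>i<N. monom (a h i) i)" for h
  have "p h \<noteq> 0" if h: "h \<in> A" for h
  proof -
    obtain j where "j < N" "a h j \<noteq> 0" using assms(2)[OF h] by blast
    then have "coeff (p h) j \<noteq> 0" by (simp add: p_def coeff_sum)
    then show ?thesis by auto
  qed
  then have "finite (\<Union>h\<in>A. {r. poly (p h) r = 0})"
    using assms(1) poly_roots_finite by blast
  then obtain r where "r \<notin> (\<Union>h\<in>A. {r. poly (p h) r = 0})"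
    using ex_new_if_finite infinite_UNIV_char_0 by blast
  then have "\<forall>h\<in>A. (\<Sum>i<N. a h i * r ^ i) \<noteq> 0"
    by (auto simp: p_def poly_sum poly_monom)
  then show ?thesis by blast
qed

text \<open>Each factor through \<open>x\<close> adds one to the multiplicity of the product at
  \<open>x\<close>; restriction to a common transversal line shows that nothing more is gained. The
  point \<open>b\<close> certifies that the product is nonzero, as the zero polynomial would have
  every multiplicity there.\<close>

lemma polynomial_cover_of_hyperplane_cover:
  assumes H: "exact_hyperplane_cover N t l T H" and b: "b \<in> cube N - T"
  shows "\<exists>P. exact_polynomial_cover N t l T P \<and> total_degree P \<le> size H"
proof -
  \<comment> \<open>One equation is chosen per hyperplane as a set, so repeated copies in
    \<open>H\<close> contribute the same linear form.\<close>
  have "\<forall>h\<in>set_mset H. \<exists>p. (\<exists>i<N. fst p i \<noteq> 0) \<and>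
      h = {x. length x = N \<and> (\<Sum>i<N. fst p i * x ! i) = snd p}"
    using H unfolding exact_hyperplane_cover_def affine_hyperplane_def by auto
  from bchoice[OF this] obtain p where p: "\<forall>h\<in>set_mset H. (\<exists>i<N. fst (p h) i \<noteq> 0) \<and>
      h = {x. length x = N \<and> (\<Sum>i<N. fst (p h) i * x ! i) = snd (p h)}"
    ..
  define a c where "a h = fst (p h)" and "c h = snd (p h)" for h
  have a: "\<exists>i<N. a h i \<noteq> 0" if "h \<in># H" for h
    using p[rule_format, OF that, THEN conjunct1] unfolding a_def .
  have mem: "x \<in> h \<longleftrightarrow> length x = N \<and> (\<Sum>i<N. a h i * x ! i) = c h" if "h \<in># H" for x h
  proof -
    have "h = {x. length x = N \<and> (\<Sum>i<N. a h i * x ! i) = c h}"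
      using p[rule_format, OF that, THEN conjunct2] unfolding a_def c_def .
    then have "x \<in> h \<longleftrightarrow> x \<in> {x. length x = N \<and> (\<Sum>i<N. a h i * x ! i) = c h}"
      by (rule arg_cong)
    then show ?thesis by simp
  qed
  define L where "L h = affine_form N (a h) (c h)" for h
  define P where "P = (\<Prod>h\<in>#H. L h)"
  have vars: "poly_in_vars N (\<Prod>h\<in>#M. L h)" for M
    by (induction M) (auto simp: L_def intro: poly_in_vars_mult poly_in_vars_affine_form
        simp flip: single_one)
  have deg: "total_degree (\<Prod>h\<in>#M. L h) \<le> size M" for M
  proof (induction M)
    case empty
    then show ?case using total_degree_single_le[of 0 1] by simp
  next
    case (add h M)
    then show ?case
      using total_degree_mult_le[OF total_degree_affine_form add] by (simp add: L_def)
  qed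
  have ge: "mult_at_least N (\<Prod>h\<in>#M. L h) x (size {#h \<in># M. x \<in> h#})" if "set_mset M \<subseteq> set_mset H" for M x
    using that
  proof (induction M)
    case (add h M)
    then have IH: "mult_at_least N (\<Prod>h\<in>#M. L h) x (size {#h \<in># M. x \<in> h#})"
      and h: "h \<in># H"
      by simp_all
    show ?case
    proof (cases "x \<in> h")
      case True
      then have "eval_at (L h) x = 0"
        using mem[OF h] by (simp add: eval_at_eq L_def poly_eval_affine_form)
      then show ?thesis
        using mult_at_least_mult_Suc[OF _ IH] True by (simp add: mult.commute[of "L h"])
    next
      case False
      then show ?thesis
        using mult_at_least_mult_right[OF IH, of "L h"] by (simp add: mult.commute[of "L h"])
    qed
  qed simp
  obtain v where v: "\<And>h. h \<in># H \<Longrightarrow> (\<Sum>i<N. a h i * v i) \<noteq> 0"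
    using ex_common_transversal[of "set_mset H" N a] a by auto
  have exact: "\<not> mult_at_least N P x (Suc (size {#h \<in># H. x \<in> h#}))" if len: "length x = N" for x
  proof
    assume m: "mult_at_least N P x (Suc (size {#h \<in># H. x \<in> h#}))"
    define d where "d h = (\<Sum>i<N. a h i * v i)" for h
    define e where "e h = (\<Sum>i<N. a h i * x ! i) - c h" for h
    \<comment> \<open>On the line every form is \<open>e h + s * d h\<close>, with
      \<open>e h = 0\<close> exactly for the hyperplanes through \<open>x\<close>. Pulling out their
      factors \<open>s\<close> leaves \<open>g\<close>, and at \<open>s = 0\<close> the product
      consists of nonzero \<open>d h\<close> and nonzero \<open>e h\<close>.\<close>
    define g where "g M s = (\<Prod>h\<in>#M. if x \<in> h then d h else e h + s * d h)" for M :: "real list set multiset" and s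
    have line: "poly_eval (\<lambda>i. x ! i + s * v i) (L h) = e h + s * d h" for h s
      by (simp add: L_def poly_eval_affine_form e_def d_def algebra_simps sum.distrib sum_distrib_left)
    have e0: "e h = 0 \<longleftrightarrow> x \<in> h" if "h \<in># H" for h
      using mem[OF that, of x] by (simp add: e_def len)
    have "poly_eval (\<lambda>i. x ! i + s * v i) (\<Prod>h\<in>#M. L h) = s ^ size {#h \<in># M. x \<in> h#} * g M s"
      if "set_mset M \<subseteq> set_mset H" for M s
      using that
    proof (induction M)
      case (add h M)
      then have "h \<in># H" "set_mset M \<subseteq> set_mset H" by simp_all
      have "poly_eval (\<lambda>i. x ! i + s * v i) (\<Prod>h\<in>#add_mset h M. L h) =
          (e h + s * d h) * (s ^ size {#h \<in># M. x \<in> h#} * g M s)"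
        using add.IH[OF \<open>set_mset M \<subseteq> set_mset H\<close>] by (simp add: line)
      then show ?case
        using e0[OF \<open>h \<in># H\<close>] by (cases "x \<in> h") (simp_all add: g_def)
    qed (simp add: g_def)
    then have "poly_eval (\<lambda>i. x ! i + s * v i) P = s ^ size {#h \<in># H. x \<in> h#} * g H s" for s
      by (simp add: P_def)
    moreover have "isCont (g M) 0" for M
    proof (induction M)
      case (add h M)
      then show ?case by (cases "x \<in> h") (auto simp: g_def intro!: continuous_intros)
    qed (simp add: g_def)
    moreover obtain C where "\<And>s. \<bar>s\<bar> \<le> 1 \<Longrightarrow>
        \<bar>poly_eval (\<lambda>i. x ! i + s * v i) P\<bar> \<le> C * \<bar>s\<bar> ^ Suc (size {#h \<in># H. x \<in> h#})"
      using mult_at_least_line_bound[OF vars[of H, folded P_def] m] by blast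
    ultimately have "g H 0 = 0"
      by (intro leading_coeff_eq_0[of "g H" "size {#h \<in># H. x \<in> h#}" C]) auto
    then have "0 \<in># {#if x \<in> h then d h else e h + 0 * d h. h \<in># H#}"
      unfolding g_def prod_mset_zero_iff .
    then obtain h where h: "h \<in># H" "0 = (if x \<in> h then d h else e h + 0 * d h)"
      unfolding in_image_mset by (rule imageE)
    show False
    proof (cases "x \<in> h")
      case True
      then show False using v[OF h(1)] h(2) unfolding d_def by simp
    next
      case False
      then show False using e0[OF h(1)] h(2) by simp
    qed
  qed
  have b': "length b = N" "size {#h \<in># H. b \<in> h#} = l"
    using b H by (auto simp: cube_def exact_hyperplane_cover_def)
  have "P \<noteq> 0" using exact[OF b'(1)] by auto
  note iff = mult_at_ge_iff[OF vars[of H, folded P_def] this]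
  have "t \<le> mult_at N P x" if "x \<in> T" for x
  proof -
    have "t \<le> size {#h \<in># H. x \<in> h#}" using H that by (simp add: exact_hyperplane_cover_def)
    then show ?thesis
      unfolding iff using mult_at_least_mono[OF ge[of H x, folded P_def]] by simp
  qed
  moreover have "mult_at N P x = l" if "x \<in> cube N - T" for x
  proof -
    have "length x = N" "size {#h \<in># H. x \<in> h#} = l"
      using that H by (auto simp: cube_def exact_hyperplane_cover_def)
    then have "l \<le> mult_at N P x" "\<not> Suc l \<le> mult_at N P x"
      unfolding iff using ge[of H x, folded P_def] exact[of x] by simp_all
    then show ?thesis by simp
  qed
  ultimately have "exact_polynomial_cover N t l T P"
    using vars[of H] \<open>P \<noteq> 0\<close> by (simp add: exact_polynomial_cover_def P_def)
  then show ?thesis using deg[of H, folded P_def] by blast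
qed

lemma EPC_le_EHC:
  assumes "cube N - T \<noteq> {}"
  shows "EPC N t l T \<le> EHC N t l T"
  unfolding EHC_def
proof (rule INF_greatest)
  fix H assume "H \<in> {H. exact_hyperplane_cover N t l T H}"
  then obtain P where P: "exact_polynomial_cover N t l T P" "total_degree P \<le> size H"
    using polynomial_cover_of_hyperplane_cover assms by blast
  then have "EPC N t l T \<le> enat (total_degree P)" unfolding EPC_def by (intro INF_lower) simp
  also have "\<dots> \<le> enat (size H)" using P(2) by simp
  finally show "EPC N t l T \<le> enat (size H)" .
qed

section \<open>Polynomials vanishing to high order on the cube\<close>

inductive fun_degree_le :: "nat \<Rightarrow> ((nat \<Rightarrow> real) \<Rightarrow> real) \<Rightarrow> bool" where
  const: "fun_degree_le d (\<lambda>x. c)"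
| coord: "fun_degree_le d f \<Longrightarrow> fun_degree_le (Suc d) (\<lambda>x. x i * f x)"
| add: "fun_degree_le d f \<Longrightarrow> fun_degree_le d g \<Longrightarrow> fun_degree_le d (\<lambda>x. f x + g x)"

lemma fun_degree_le_mono: "fun_degree_le d f \<Longrightarrow> d \<le> e \<Longrightarrow> fun_degree_le e f"
proof (induction arbitrary: e rule: fun_degree_le.induct)
  case (coord d f i)
  then obtain e' where "e = Suc e'" "d \<le> e'" by (cases e) auto
  then show ?case using coord by (auto intro: fun_degree_le.coord)
qed (auto intro: fun_degree_le.intros)

lemma fun_degree_le_scale: "fun_degree_le d f \<Longrightarrow> fun_degree_le d (\<lambda>x. c * f x)"
proof (induction rule: fun_degree_le.induct)
  case (coord d f i)
  then show ?case using fun_degree_le.coord[of d "\<lambda>x. c * f x" i] by (simp add: mult.left_commute)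
next
  case (add d f g)
  then show ?case using fun_degree_le.add[of d "\<lambda>x. c * f x" "\<lambda>x. c * g x"] by (simp add: distrib_left)
qed (auto intro: fun_degree_le.const)

lemma fun_degree_le_sum:
  "(\<And>a. a \<in> A \<Longrightarrow> fun_degree_le d (f a)) \<Longrightarrow> fun_degree_le d (\<lambda>x. \<Sum>a\<in>A. f a x)"
  by (induction A rule: infinite_finite_induct) (auto intro: fun_degree_le.intros)

lemma fun_degree_le_power_mult:
  "fun_degree_le d f \<Longrightarrow> fun_degree_le (d + k) (\<lambda>x. x i ^ k * f x)"
proof (induction k)
  case (Suc k)
  then show ?case
    using fun_degree_le.coord[of "d + k" "\<lambda>x. x i ^ k * f x" i] by (simp add: mult.assoc)
qed simp

lemma fun_degree_le_monomial:
  "fun_degree_le (\<Sum>i<N. e i) (\<lambda>x. \<Prod>i<N. x i ^ e i)"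
proof (induction N)
  case 0
  show ?case by (simp add: fun_degree_le.const)
next
  case (Suc N)
  then show ?case using fun_degree_le_power_mult[OF Suc, of "e N" N] by (simp add: mult.commute)
qed

text \<open>A monic sequence with one member in each degree, adapted to the roots 0 and 1: a power
  of \<open>x (x - 1)\<close>, with an extra \<open>x\<close> in odd degree. The type is generic
  because it is used both for the variables of a polynomial and for real values.\<close>

definition phi :: "nat \<Rightarrow> 'a::comm_ring_1 \<Rightarrow> 'a" where
  "phi j x = (x * (x - 1)) ^ (j div 2) * x ^ (j mod 2)"

lemma phi_0 [simp]: "phi 0 x = 1"
  by (simp add: phi_def)

text \<open>For odd \<open>j\<close> this is \<open>x\<^sup>2 = x (x - 1) + x\<close>; for even
  \<open>j\<close> the next member just has one more \<open>x\<close>. It is the only rewriting rule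
  needed to pass from monomials to the basis.\<close>

lemma times_phi: "x * phi j x = phi (Suc j) x + (if odd j then phi j x else 0)"
proof (cases "even j")
  case True
  then obtain q where "j = 2 * q" by (auto elim!: evenE)
  then have "phi j x = (x * (x - 1)) ^ q" "phi (Suc j) x = (x * (x - 1)) ^ q * x"
    by (auto simp: phi_def)
  then show ?thesis using True by (simp add: mult.commute)
next
  case False
  then obtain q where "j = Suc (2 * q)" by (auto elim!: oddE)
  then have "phi j x = (x * (x - 1)) ^ q * x" "phi (Suc j) x = (x * (x - 1)) ^ q * (x * (x - 1))"
    by (auto simp: phi_def)
  then show ?thesis using False by (simp add: algebra_simps)
qed

definition basis :: "nat \<Rightarrow> (nat \<Rightarrow>\<^sub>0 nat) \<Rightarrow> real_mpoly" where
  "basis N m = (\<Prod>i<N. phi (Poly_Mapping.lookup m i) (mvar i))"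

text \<open>Here \<open>c\<close> is a family of coefficients: its monomial \<open>m\<close> stands
  for \<open>basis N m\<close>. Storing the family as a polynomial makes \<open>poly_in_vars\<close>
  and \<open>total_degree\<close> applicable to it.\<close>

definition expand :: "nat \<Rightarrow> real_mpoly \<Rightarrow> real_mpoly" where
  "expand N c = (\<Sum>m\<in>Poly_Mapping.keys c. mconst (Poly_Mapping.lookup c m) * basis N m)"

lemma mvar_times_basis:
  assumes "i < N"
  shows "mvar i * basis N m = basis N (m + Poly_Mapping.single i 1) +
    (if odd (Poly_Mapping.lookup m i) then basis N m else 0)"
proof -
  let ?R = "\<lambda>m. \<Prod>j\<in>{..<N} - {i}. phi (Poly_Mapping.lookup m j) (mvar j)"
  have split: "basis N m = phi (Poly_Mapping.lookup m i) (mvar i) * ?R m" for m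
    unfolding basis_def by (rule prod.remove) (use assms in auto)
  have R: "?R (m + Poly_Mapping.single i 1) = ?R m"
    by (rule prod.cong) (auto simp: lookup_add lookup_single_not_eq)
  have "mvar i * basis N m = (mvar i * phi (Poly_Mapping.lookup m i) (mvar i)) * ?R m"
    by (simp only: split mult.assoc)
  also have "\<dots> = basis N (m + Poly_Mapping.single i 1) +
    (if odd (Poly_Mapping.lookup m i) then basis N m else 0)"
    unfolding times_phi split[of "m + Poly_Mapping.single i 1"] R
    by (simp add: lookup_add distrib_right split)
  finally show ?thesis .
qed

lemma expand_add: "expand N (c + c') = expand N c + expand N c'"
  unfolding expand_def by (rule setsum_keys_plus_distrib) (auto simp: single_add distrib_right)

lemma expand_single: "expand N (Poly_Mapping.single m k) = mconst k * basis N m"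
  by (cases "k = 0") (auto simp: expand_def)

definition expandable :: "nat \<Rightarrow> nat \<Rightarrow> real_mpoly \<Rightarrow> bool" where
  "expandable N d P \<longleftrightarrow> (\<exists>c. poly_in_vars N c \<and> total_degree c \<le> d \<and> P = expand N c)"

lemma expandable_add: "expandable N d P \<Longrightarrow> expandable N d Q \<Longrightarrow> expandable N d (P + Q)"
  unfolding expandable_def by (metis poly_in_vars_add total_degree_add_le expand_add)

lemma expandable_0: "expandable N d 0"
  unfolding expandable_def by (rule exI[of _ 0]) (simp add: expand_def total_degree_def)

lemma expandable_sum: "(\<And>a. a \<in> A \<Longrightarrow> expandable N d (f a)) \<Longrightarrow> expandable N d (sum f A)"
  by (induction A rule: infinite_finite_induct) (auto intro: expandable_add expandable_0)

lemma expandable_mono: "expandable N d P \<Longrightarrow> d \<le> e \<Longrightarrow> expandable N e P"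
  unfolding expandable_def using order_trans by blast

lemma expandable_basis:
  assumes "Poly_Mapping.keys m \<subseteq> {..<N}" "exp_degree m \<le> d"
  shows "expandable N d (mconst k * basis N m)"
  unfolding expandable_def
proof (intro exI conjI)
  show "poly_in_vars N (Poly_Mapping.single m k)" using assms by (auto simp: poly_in_vars_def)
  show "total_degree (Poly_Mapping.single m k) \<le> d"
    using total_degree_single_le assms(2) by (rule order_trans)
qed (simp add: expand_single)

lemma expandable_mvar_times:
  assumes "expandable N d P" "i < N"
  shows "expandable N (Suc d) (mvar i * P)"
proof -
  obtain c where c: "poly_in_vars N c" "total_degree c \<le> d" "P = expand N c"
    using assms(1) unfolding expandable_def by blast
  have "expandable N (Suc d) (mvar i * (mconst k * basis N m))" if "m \<in> Poly_Mapping.keys c" for m k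
  proof -
    have m: "Poly_Mapping.keys m \<subseteq> {..<N}" "exp_degree m \<le> d"
      using that c by (auto simp: poly_in_vars_def total_degree_le_iff)
    have "Poly_Mapping.keys (m + Poly_Mapping.single i 1) \<subseteq> {..<N}"
      using Poly_Mapping.keys_add[of m "Poly_Mapping.single i 1"] m(1) assms(2) by auto
    then have "expandable N (Suc d) (mconst k * basis N (m + Poly_Mapping.single i 1))"
      by (rule expandable_basis) (use m in \<open>simp add: exp_degree_add\<close>)
    moreover have "expandable N (Suc d) (mconst (if odd (Poly_Mapping.lookup m i) then k else 0) * basis N m)"
      using m by (intro expandable_basis) auto
    moreover have "mvar i * (mconst k * basis N m) = mconst k * basis N (m + Poly_Mapping.single i 1)
        + mconst (if odd (Poly_Mapping.lookup m i) then k else 0) * basis N m"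
      unfolding mult.left_commute[of "mvar i"] mvar_times_basis[OF assms(2)]
      by (simp add: distrib_left)
    ultimately show ?thesis using expandable_add by simp
  qed
  then show ?thesis
    unfolding c(3) expand_def sum_distrib_left by (intro expandable_sum) auto
qed

text \<open>Starting from a constant, each variable factor raises the bound by one through
  \<open>expandable_mvar_times\<close>, so the expansion involves no degree above that of
  \<open>P\<close>.\<close>

lemma expandable_of_total_degree:
  assumes "poly_in_vars N P" "total_degree P \<le> d"
  shows "expandable N d P"
proof (induction P rule: mpoly_sum_induct)
  case (single m)
  then have "Poly_Mapping.keys m \<subseteq> {..<N}" and deg: "exp_degree m \<le> d"
    using assms by (auto simp: poly_in_vars_def total_degree_le_iff)
  then have "expandable N (exp_degree m) (Poly_Mapping.single m k)" for k
  proof (induction m rule: exp_induct)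
    case zero
    then show ?case using expandable_basis[of 0 N 0 k] by (simp add: basis_def)
  next
    case (add m i)
    then show ?case using expandable_mvar_times[OF add.IH, of i]
      by (simp add: mult_single exp_degree_add add.commute)
  qed
  then show ?case using deg expandable_mono by blast
qed (auto intro: expandable_0 expandable_add)

text \<open>A polynomial that vanishes on the grid \<open>A ^ N\<close> and has all exponents below
  \<open>card A\<close> is zero; for infinite \<open>A\<close> the exponents are unrestricted.
  Several \<open>m\<close> may share an exponent vector, so the coefficient is a sum. Used with all
  reals and with {0, 1}.\<close>

lemma sum_prod_powers_coeff_eq_0:
  fixes g :: "'m \<Rightarrow> nat \<Rightarrow> nat" and b :: "'m \<Rightarrow> real"
  assumes "finite M" and "\<And>m i. m \<in> M \<Longrightarrow> i < N \<Longrightarrow> finite A \<Longrightarrow> g m i < card A"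
    and "\<And>x. (\<And>i. i < N \<Longrightarrow> x i \<in> A) \<Longrightarrow> (\<Sum>m\<in>M. b m * (\<Prod>i<N. x i ^ g m i)) = 0"
  shows "(\<Sum>m | m \<in> M \<and> (\<forall>i<N. g m i = \<gamma> i). b m) = 0"
  using assms
proof (induction N arbitrary: M)
  case 0
  then show ?case by simp
next
  case (Suc N)
  let ?M = "{m \<in> M. g m N = \<gamma> N}"
  have "(\<Sum>m | m \<in> ?M \<and> (\<forall>i<N. g m i = \<gamma> i). b m) = 0"
  proof (rule Suc.IH)
    fix x :: "nat \<Rightarrow> real" assume x: "\<And>i. i < N \<Longrightarrow> x i \<in> A"
    \<comment> \<open>The sum as a univariate polynomial in the last variable, the others being
      fixed. All of \<open>A\<close> are roots; if \<open>p\<close> were nonzero, \<open>A\<close>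
      would be finite and the exponent bound would put the degree below the number of roots.\<close>
    define p where "p = (\<Sum>m\<in>M. monom (b m * (\<Prod>i<N. x i ^ g m i)) (g m N))"
    have coeff: "coeff p j = (\<Sum>m | m \<in> M \<and> g m N = j. b m * (\<Prod>i<N. x i ^ g m i))" for j
      unfolding p_def coeff_sum using Suc.prems(1) by (simp add: sum.If_cases Int_def)
    have root: "poly p z = 0" if "z \<in> A" for z
    proof -
      have "(\<Sum>m\<in>M. b m * (\<Prod>i<Suc N. (x(N := z)) i ^ g m i)) = 0"
        by (rule Suc.prems(3)) (use x that in \<open>auto simp: less_Suc_eq\<close>)
      then show ?thesis by (simp add: p_def poly_sum poly_monom mult.assoc)
    qed
    have "p = 0"
    proof (rule ccontr)
      assume "p \<noteq> 0"
      then have fin: "finite A"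
        using poly_roots_finite[of p] root by (auto intro: finite_subset[of A "{z. poly p z = 0}"])
      have "card A \<le> card {z. poly p z = 0}"
        using poly_roots_finite[OF \<open>p \<noteq> 0\<close>] root by (intro card_mono) auto
      also have "\<dots> \<le> degree p" using \<open>p \<noteq> 0\<close> by (rule card_poly_roots_bound)
      finally have "card A \<le> degree p" .
      have "coeff p (degree p) \<noteq> 0" using \<open>p \<noteq> 0\<close> by simp
      then obtain m where "m \<in> M" "g m N = degree p"
        unfolding coeff by (metis (mono_tags, lifting) mem_Collect_eq sum.neutral)
      then show False using Suc.prems(2)[of m N] fin \<open>card A \<le> degree p\<close> by simp
    qed
    then show "(\<Sum>m\<in>?M. b m * (\<Prod>i<N. x i ^ g m i)) = 0"
      using coeff[of "\<gamma> N"] by simp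
  qed (use Suc.prems in auto)
  moreover have "{m. m \<in> ?M \<and> (\<forall>i<N. g m i = \<gamma> i)} = {m. m \<in> M \<and> (\<forall>i<Suc N. g m i = \<gamma> i)}"
    by (auto simp: less_Suc_eq)
  ultimately show ?case by simp
qed

section \<open>Residues and multiplicity on the cube\<close>

definition halves :: "(nat \<Rightarrow>\<^sub>0 nat) \<Rightarrow> nat \<Rightarrow> nat" where
  "halves m i = Poly_Mapping.lookup m i div 2"

text \<open>The values of the multilinear coefficient \<open>R\<^sub>\<gamma>\<close> of the product
  of the \<open>(x\<^sub>i (x\<^sub>i - 1)) ^ \<gamma>\<^sub>i\<close> in the expansion.\<close>

definition residue :: "nat \<Rightarrow> real_mpoly \<Rightarrow> (nat \<Rightarrow> nat) \<Rightarrow> (nat \<Rightarrow> real) \<Rightarrow> real" where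
  "residue N c \<gamma> x = (\<Sum>m | m \<in> Poly_Mapping.keys c \<and> halves m = \<gamma>.
     Poly_Mapping.lookup c m * (\<Prod>i<N. x i ^ (Poly_Mapping.lookup m i mod 2)))"

lemma residue_cong:
  "(\<And>i. i < N \<Longrightarrow> x i = x' i) \<Longrightarrow> residue N c \<gamma> x = residue N c \<gamma> x'"
  unfolding residue_def by (intro sum.cong prod.cong arg_cong2[where f = times]) auto

lemma poly_eval_expand:
  "poly_eval x (expand N c) = (\<Sum>m\<in>Poly_Mapping.keys c.
     Poly_Mapping.lookup c m * (\<Prod>i<N. phi (Poly_Mapping.lookup m i) (x i)))"
  by (simp add: expand_def basis_def phi_def)

lemma halves_eq_iff:
  assumes "poly_in_vars N c" "m \<in> Poly_Mapping.keys c" "m' \<in> Poly_Mapping.keys c"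
  shows "(\<forall>i<N. halves m i = halves m' i) \<longleftrightarrow> halves m = halves m'"
proof
  assume eq: "\<forall>i<N. halves m i = halves m' i"
  show "halves m = halves m'"
  proof
    fix i
    show "halves m i = halves m' i"
    proof (cases "i < N")
      case False
      then have "i \<notin> Poly_Mapping.keys m" "i \<notin> Poly_Mapping.keys m'"
        using assms by (auto simp: poly_in_vars_def)
      then show ?thesis by (simp add: halves_def in_keys_iff)
    qed (use eq in blast)
  qed
qed simp

text \<open>
  Near a point \<open>a\<close> of the cube, the substitution \<open>x\<^sub>i = a\<^sub>i + s (2 a\<^sub>i - 1) u\<^sub>i\<close>
  turns \<open>x\<^sub>i (x\<^sub>i - 1)\<close> into \<open>s u\<^sub>i (1 + s u\<^sub>i)\<close>, whatever the value of \<open>a\<^sub>i\<close>.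
\<close>

lemma leading_form_eq_0:
  assumes vars: "poly_in_vars N (expand N c)"
    and l: "\<And>m. m \<in> Poly_Mapping.keys c \<Longrightarrow> l \<le> (\<Sum>i<N. halves m i)"
    and a: "a \<in> cube N" "mult_at_least N (expand N c) a (Suc l)"
  shows "(\<Sum>m | m \<in> Poly_Mapping.keys c \<and> (\<Sum>i<N. halves m i) = l.
    Poly_Mapping.lookup c m * (\<Prod>i<N. a ! i ^ (Poly_Mapping.lookup m i mod 2)) * (\<Prod>i<N. u i ^ halves m i)) = 0"
proof -
  let ?w = "\<lambda>m. \<Sum>i<N. halves m i"
  let ?x = "\<lambda>s i. a ! i + s * ((2 * a ! i - 1) * u i)"
  define g where "g s = (\<Sum>m\<in>Poly_Mapping.keys c. Poly_Mapping.lookup c m * s ^ (?w m - l) *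
    (\<Prod>i<N. (u i * (1 + s * u i)) ^ halves m i * ?x s i ^ (Poly_Mapping.lookup m i mod 2)))" for s
  have phi: "phi j (?x s i) = s ^ (j div 2) * ((u i * (1 + s * u i)) ^ (j div 2) * ?x s i ^ (j mod 2))"
    if "i < N" for i j s
  proof -
    have "a ! i = 0 \<or> a ! i = 1" using a(1) that by (auto simp: cube_def dest: nth_mem)
    then have "?x s i * (?x s i - 1) = s * (u i * (1 + s * u i))"
      by (auto simp: algebra_simps)
    then show ?thesis unfolding phi_def by (simp only: power_mult_distrib mult.assoc)
  qed
  have "poly_eval (?x s) (expand N c) = s ^ l * g s" for s
    unfolding poly_eval_expand g_def sum_distrib_left
  proof (rule sum.cong[OF refl])
    fix m assume m: "m \<in> Poly_Mapping.keys c"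
    have "(\<Prod>i<N. phi (Poly_Mapping.lookup m i) (?x s i)) = (\<Prod>i<N. s ^ halves m i *
        ((u i * (1 + s * u i)) ^ halves m i * ?x s i ^ (Poly_Mapping.lookup m i mod 2)))"
      by (rule prod.cong) (auto simp: phi halves_def)
    also have "\<dots> = s ^ l * s ^ (?w m - l) * (\<Prod>i<N. (u i * (1 + s * u i)) ^ halves m i * ?x s i ^ (Poly_Mapping.lookup m i mod 2))"
      unfolding prod.distrib[of "\<lambda>i. s ^ halves m i"] power_sum[symmetric] power_add[symmetric]
      using l[OF m] by simp
    finally show "Poly_Mapping.lookup c m * (\<Prod>i<N. phi (Poly_Mapping.lookup m i) (?x s i)) =
      s ^ l * (Poly_Mapping.lookup c m * s ^ (?w m - l) *
        (\<Prod>i<N. (u i * (1 + s * u i)) ^ halves m i * ?x s i ^ (Poly_Mapping.lookup m i mod 2)))"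
      by (simp only: ac_simps)
  qed
  moreover obtain C where "\<And>s. \<bar>s\<bar> \<le> 1 \<Longrightarrow> \<bar>poly_eval (?x s) (expand N c)\<bar> \<le> C * \<bar>s\<bar> ^ Suc l"
    using mult_at_least_line_bound[OF vars a(2), of "\<lambda>i. (2 * a ! i - 1) * u i"] by blast
  moreover have "isCont g 0" unfolding g_def by (intro continuous_intros)
  ultimately have "g 0 = 0" by (intro leading_coeff_eq_0[of g l C]) auto
  \<comment> \<open>At \<open>s = 0\<close> the power \<open>0 ^ (?w m - l)\<close> removes every
    term except those of minimal weight \<open>l\<close>, where \<open>0 ^ 0 = 1\<close>.\<close>
  moreover have "g 0 = (\<Sum>m | m \<in> Poly_Mapping.keys c \<and> ?w m = l.
    Poly_Mapping.lookup c m * (\<Prod>i<N. a ! i ^ (Poly_Mapping.lookup m i mod 2)) * (\<Prod>i<N. u i ^ halves m i))"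
    unfolding g_def
  proof (rule sum.mono_neutral_cong_right)
    show "\<forall>m\<in>Poly_Mapping.keys c - {m \<in> Poly_Mapping.keys c. ?w m = l}.
       Poly_Mapping.lookup c m * 0 ^ (?w m - l) *
       (\<Prod>i<N. (u i * (1 + 0 * u i)) ^ halves m i * ?x 0 i ^ (Poly_Mapping.lookup m i mod 2)) = 0"
    proof
      fix m assume m: "m \<in> Poly_Mapping.keys c - {m \<in> Poly_Mapping.keys c. ?w m = l}"
      then have "l \<le> ?w m" "?w m \<noteq> l" using l[of m] by auto
      then have "l < ?w m" by linarith
      then show "Poly_Mapping.lookup c m * 0 ^ (?w m - l) *
       (\<Prod>i<N. (u i * (1 + 0 * u i)) ^ halves m i * ?x 0 i ^ (Poly_Mapping.lookup m i mod 2)) = 0"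
        by (simp add: zero_power)
    qed
  qed (auto simp: prod.distrib)
  ultimately show ?thesis by simp
qed

text \<open>The leading form vanishes for every direction \<open>u\<close>, hence vanishes as a
  polynomial in \<open>u\<close>; its coefficients are the residues at \<open>a\<close>.\<close>

lemma residue_eq_0:
  assumes vars: "poly_in_vars N (expand N c)" "poly_in_vars N c"
    and l: "\<And>m. m \<in> Poly_Mapping.keys c \<Longrightarrow> l \<le> (\<Sum>i<N. halves m i)"
    and a: "a \<in> cube N" "mult_at_least N (expand N c) a (Suc l)"
    and m0: "m0 \<in> Poly_Mapping.keys c" "(\<Sum>i<N. halves m0 i) = l"
  shows "residue N c (halves m0) ((!) a) = 0"
proof -
  let ?M = "{m \<in> Poly_Mapping.keys c. (\<Sum>i<N. halves m i) = l}"
  let ?b = "\<lambda>m. Poly_Mapping.lookup c m * (\<Prod>i<N. a ! i ^ (Poly_Mapping.lookup m i mod 2))"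
  have "(\<Sum>m | m \<in> ?M \<and> (\<forall>i<N. halves m i = halves m0 i). ?b m) = 0"
    using leading_form_eq_0[OF vars(1) l a]
    by (intro sum_prod_powers_coeff_eq_0[where A = UNIV]) (auto simp: infinite_UNIV_char_0)
  moreover have "{m. m \<in> ?M \<and> (\<forall>i<N. halves m i = halves m0 i)} =
      {m. m \<in> Poly_Mapping.keys c \<and> halves m = halves m0}"
    using halves_eq_iff[OF vars(2) _ m0(1)] m0(2) by auto
  ultimately show ?thesis by (simp add: residue_def)
qed

text \<open>A multilinear polynomial that vanishes on the cube has zero coefficients. Halves and
  parities together determine a monomial, so the coefficient belonging to \<open>m0\<close> is a
  single nonzero entry of \<open>c\<close>.\<close>

lemma residue_neq_0:
  assumes "poly_in_vars N c" "m0 \<in> Poly_Mapping.keys c"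
  shows "\<exists>a\<in>cube N. residue N c (halves m0) ((!) a) \<noteq> 0"
proof (rule ccontr)
  assume "\<not> ?thesis"
  then have zero: "residue N c (halves m0) ((!) a) = 0" if "a \<in> cube N" for a
    using that by blast
  let ?M = "{m \<in> Poly_Mapping.keys c. halves m = halves m0}"
  let ?r = "\<lambda>m i. Poly_Mapping.lookup m i mod 2"
  have "(\<Sum>m | m \<in> ?M \<and> (\<forall>i<N. ?r m i = ?r m0 i). Poly_Mapping.lookup c m) = 0"
  proof (rule sum_prod_powers_coeff_eq_0[where A = "{0, 1}"])
    fix x :: "nat \<Rightarrow> real" assume x: "\<And>i. i < N \<Longrightarrow> x i \<in> {0, 1}"
    define a where "a = map x [0..<N]"
    have "a \<in> cube N" using x by (fastforce simp: a_def cube_def)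
    moreover have "residue N c (halves m0) ((!) a) = residue N c (halves m0) x"
      by (rule residue_cong) (simp add: a_def)
    ultimately show "(\<Sum>m\<in>?M. Poly_Mapping.lookup c m * (\<Prod>i<N. x i ^ ?r m i)) = 0"
      using zero[of a] by (simp add: residue_def)
  qed (auto simp: card_insert_if)
  moreover have "m = m0" if "m \<in> ?M" "\<forall>i<N. ?r m i = ?r m0 i" for m
  proof (rule poly_mapping_eqI)
    fix i
    show "Poly_Mapping.lookup m i = Poly_Mapping.lookup m0 i"
    proof (cases "i < N")
      case True
      have "Poly_Mapping.lookup m i div 2 = Poly_Mapping.lookup m0 i div 2"
        using that(1) halves_def[of m i] halves_def[of m0 i] by simp
      then show ?thesis using that(2) True by (metis div_mult_mod_eq)
    next
      case False
      then have "i \<notin> Poly_Mapping.keys m" "i \<notin> Poly_Mapping.keys m0"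
        using assms that by (auto simp: poly_in_vars_def)
      then show ?thesis by (simp add: in_keys_iff)
    qed
  qed
  then have "{m. m \<in> ?M \<and> (\<forall>i<N. ?r m i = ?r m0 i)} = {m0}" using assms(2) by auto
  ultimately show False using assms(2) by (simp add: in_keys_iff)
qed

text \<open>Induction on \<open>l\<close>: a term of weight exactly \<open>l\<close> would have a
  residue that vanishes on the whole cube by \<open>residue_eq_0\<close>, against
  \<open>residue_neq_0\<close>.\<close>

lemma le_halves_of_mult_at_least:
  assumes vars: "poly_in_vars N (expand N c)" "poly_in_vars N c"
  shows "(\<And>a. a \<in> cube N \<Longrightarrow> mult_at_least N (expand N c) a l) \<Longrightarrow>
    m \<in> Poly_Mapping.keys c \<Longrightarrow> l \<le> (\<Sum>i<N. halves m i)"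
proof (induction l arbitrary: m)
  case (Suc l)
  have IH: "l \<le> (\<Sum>i<N. halves m i)" if "m \<in> Poly_Mapping.keys c" for m
    using Suc.IH[OF _ that] Suc.prems(1) mult_at_least_mono[of N _ _ "Suc l" l] by simp
  have "(\<Sum>i<N. halves m i) \<noteq> l"
    using residue_eq_0[OF vars IH _ Suc.prems(1) Suc.prems(2)]
      residue_neq_0[OF vars(2) Suc.prems(2)] by blast
  then show ?case using IH[OF Suc.prems(2)] by simp
qed simp

text \<open>Converse of \<open>residue_eq_0\<close>. Grouping by \<open>\<gamma>\<close>, the
  factors \<open>x\<^sub>i (x\<^sub>i - 1)\<close> vanish at \<open>y\<close> and give order
  \<open>|\<gamma>|\<close>; if this is only \<open>l\<close>, the vanishing residue supplies one
  more.\<close>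

lemma mult_at_least_of_residue_eq_0:
  assumes vars: "poly_in_vars N c"
    and l: "\<And>m. m \<in> Poly_Mapping.keys c \<Longrightarrow> l \<le> (\<Sum>i<N. halves m i)"
    and y: "y \<in> cube N"
    and res: "\<And>m. m \<in> Poly_Mapping.keys c \<Longrightarrow> (\<Sum>i<N. halves m i) = l \<Longrightarrow>
      residue N c (halves m) ((!) y) = 0"
  shows "mult_at_least N (expand N c) y (Suc l)"
proof -
  let ?z = "\<lambda>i. mvar i * (mvar i - 1)"
  let ?q = "\<lambda>m. mconst (Poly_Mapping.lookup c m) * (\<Prod>i<N. mvar i ^ (Poly_Mapping.lookup m i mod 2))"
  have z: "eval_at (?z i) y = 0" if "i \<in> {..<N}" for i
  proof -
    have "y ! i = 0 \<or> y ! i = 1" using y that by (auto simp: cube_def dest: nth_mem)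
    then show ?thesis by (auto simp: eval_at_eq)
  qed
  have "expand N c = (\<Sum>m\<in>Poly_Mapping.keys c. ?q m * (\<Prod>i<N. ?z i ^ halves m i))"
    by (simp add: expand_def basis_def phi_def halves_def prod.distrib ac_simps)
  also have "\<dots> = (\<Sum>\<gamma>\<in>halves ` Poly_Mapping.keys c.
      \<Sum>m | m \<in> Poly_Mapping.keys c \<and> halves m = \<gamma>. ?q m * (\<Prod>i<N. ?z i ^ halves m i))"
    by (rule sum.image_gen) simp
  also have "\<dots> = (\<Sum>\<gamma>\<in>halves ` Poly_Mapping.keys c.
      (\<Sum>m | m \<in> Poly_Mapping.keys c \<and> halves m = \<gamma>. ?q m) * (\<Prod>i<N. ?z i ^ \<gamma> i))"
    by (rule sum.cong) (auto simp: sum_distrib_right)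
  finally have e: "expand N c = \<dots>" .
  have "mult_at_least N ((\<Sum>m | m \<in> Poly_Mapping.keys c \<and> halves m = \<gamma>. ?q m) * (\<Prod>i<N. ?z i ^ \<gamma> i)) y (Suc l)"
    if \<gamma>: "\<gamma> \<in> halves ` Poly_Mapping.keys c" for \<gamma>
  proof -
    obtain m where m: "m \<in> Poly_Mapping.keys c" "\<gamma> = halves m" using \<gamma> by blast
    let ?Q = "\<Sum>m | m \<in> Poly_Mapping.keys c \<and> halves m = \<gamma>. ?q m"
    show ?thesis
    proof (cases "(\<Sum>i<N. \<gamma> i) = l")
      case True
      have "eval_at ?Q y = residue N c \<gamma> ((!) y)" by (simp add: eval_at_eq residue_def)
      then have "mult_at_least N ?Q y 1" using res[OF m(1)] True m by (simp add: mult_at_least_Suc)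
      then have "mult_at_least N (?Q * (\<Prod>i<N. ?z i ^ \<gamma> i)) y (1 + (\<Sum>i<N. \<gamma> i))"
        by (intro mult_at_least_mult_prod z) auto
      then show ?thesis using True by simp
    next
      case False
      then have "Suc l \<le> 0 + (\<Sum>i<N. \<gamma> i)" using l[OF m(1)] m by simp
      moreover have "mult_at_least N (?Q * (\<Prod>i<N. ?z i ^ \<gamma> i)) y (0 + (\<Sum>i<N. \<gamma> i))"
        by (rule mult_at_least_mult_prod) (use z in auto)
      ultimately show ?thesis using mult_at_least_mono by blast
    qed
  qed
  then show ?thesis unfolding e by (rule mult_at_least_sum)
qed

text \<open>The function is a residue of weight \<open>l\<close> that does not vanish at
  \<open>y\<close>. Removing \<open>l\<close> factors of degree 2 costs \<open>2 * l\<close>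
  degrees. The last conjunct is needed because \<open>(!) a\<close> is unspecified beyond the length
  of the list.\<close>

lemma ex_reduced_function:
  assumes P: "poly_in_vars N P" and l: "\<And>a. a \<in> cube N \<Longrightarrow> mult_at_least N P a l"
    and y: "y \<in> cube N" "\<not> mult_at_least N P y (Suc l)"
  shows "\<exists>f d. fun_degree_le d f \<and> d + 2 * l \<le> total_degree P \<and> f ((!) y) \<noteq> 0 \<and>
    (\<forall>a\<in>cube N. mult_at_least N P a (Suc l) \<longrightarrow> f ((!) a) = 0) \<and>
    (\<forall>x x'. (\<forall>i<N. x i = x' i) \<longrightarrow> f x = f x')"
proof -
  obtain c where c: "poly_in_vars N c" "total_degree c \<le> total_degree P" "P = expand N c"
    using expandable_of_total_degree[OF P order_refl] unfolding expandable_def by blast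
  note le = le_halves_of_mult_at_least[OF P[unfolded c(3)] c(1) l[unfolded c(3)]]
  obtain m where m: "m \<in> Poly_Mapping.keys c" "(\<Sum>i<N. halves m i) = l"
      "residue N c (halves m) ((!) y) \<noteq> 0"
    using mult_at_least_of_residue_eq_0[OF c(1) le y(1)] y(2) c(3) by blast
  have deg: "(\<Sum>i<N. Poly_Mapping.lookup m' i mod 2) + 2 * l \<le> total_degree P"
    if "m' \<in> Poly_Mapping.keys c" "halves m' = halves m" for m'
  proof -
    have "Poly_Mapping.keys m' \<subseteq> {..<N}" using c(1) that by (auto simp: poly_in_vars_def)
    then have "exp_degree m' = (\<Sum>i<N. Poly_Mapping.lookup m' i mod 2 + 2 * halves m' i)"
      by (simp add: exp_degree_superset[of "{..<N}"] halves_def)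
    also have "\<dots> = (\<Sum>i<N. Poly_Mapping.lookup m' i mod 2) + 2 * l"
      using m(2) that(2) by (simp add: sum.distrib flip: sum_distrib_left)
    finally show ?thesis using c(2) that(1) unfolding total_degree_le_iff by force
  qed
  show ?thesis
  proof (intro exI conjI ballI allI impI)
    \<comment> \<open>The subtraction does not truncate: \<open>deg\<close> for \<open>m\<close>
      gives \<open>2 * l \<le> total_degree P\<close>.\<close>
    show "fun_degree_le (total_degree P - 2 * l) (residue N c (halves m))"
      unfolding residue_def
      by (intro fun_degree_le_sum fun_degree_le_scale fun_degree_le_mono[OF fun_degree_le_monomial])
        (use deg in fastforce)
    show "total_degree P - 2 * l + 2 * l \<le> total_degree P" using deg[OF m(1)] by simp
    show "residue N c (halves m) ((!) y) \<noteq> 0" by (rule m(3))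
    show "residue N c (halves m) ((!) a) = 0" if "a \<in> cube N" "mult_at_least N P a (Suc l)" for a
      by (rule residue_eq_0[OF P[unfolded c(3)] c(1) le that[unfolded c(3)] m(1,2)])
    show "residue N c (halves m) x = residue N c (halves m) x'" if "\<forall>i<N. x i = x' i" for x x'
      by (rule residue_cong) (use that in blast)
  qed
qed

section \<open>Blocks and symmetric sets\<close>

abbreviation (input) offset :: "(nat \<Rightarrow> nat) \<Rightarrow> nat \<Rightarrow> nat" where
  "offset n i \<equiv> \<Sum>j<i. n j"

definition block :: "(nat \<Rightarrow> nat) \<Rightarrow> real list \<Rightarrow> nat \<Rightarrow> real list" where
  "block n x i = take (n i) (drop (offset n i) x)"

definition block_indices :: "(nat \<Rightarrow> nat) \<Rightarrow> nat \<Rightarrow> nat set" where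
  "block_indices n i = {offset n i..<offset n (Suc i)}"

lemma offset_mono: "i \<le> k \<Longrightarrow> offset n i \<le> offset n k"
  by (rule sum_mono2) auto

lemma offset_Suc_le: "i < k \<Longrightarrow> offset n i + n i \<le> offset n k"
  using offset_mono[of "Suc i" k n] by simp

lemma length_concat_blocks:
  "(\<And>i. i < k \<Longrightarrow> length (z i) = n i) \<Longrightarrow> length (concat (map z [0..<k])) = offset n k"
  by (induction k) auto

lemma block_concat:
  assumes "\<And>i. i < k \<Longrightarrow> length (z i) = n i" "i < k"
  shows "block n (concat (map z [0..<k])) i = z i"
  using assms
proof (induction k)
  case (Suc k)
  have len: "length (concat (map z [0..<k])) = offset n k"
    using Suc.prems by (intro length_concat_blocks) auto
  show ?case
  proof (cases "i = k")
    case True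
    then show ?thesis using len Suc.prems by (simp add: block_def)
  next
    case False
    then have "i < k" using Suc.prems by simp
    then show ?thesis
      using len Suc.IH Suc.prems offset_Suc_le[of i k n] by (simp add: block_def)
  qed
qed simp

lemma concat_block:
  "length x = offset n k \<Longrightarrow> concat (map (block n x) [0..<k]) = x"
proof (induction k arbitrary: x)
  case (Suc k)
  have "block n x i = block n (take (offset n k) x) i" if "i < k" for i
  proof -
    have "n i \<le> offset n k - offset n i" using offset_Suc_le[OF that, of n] by simp
    then show ?thesis by (simp only: block_def drop_take take_take min.absorb1)
  qed
  then have "concat (map (block n x) [0..<k]) = concat (map (block n (take (offset n k) x)) [0..<k])"
    by (auto intro!: arg_cong[where f = concat])
  also have "\<dots> = take (offset n k) x"
    using Suc.prems by (intro Suc.IH) simp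
  finally have "concat (map (block n x) [0..<k]) = take (offset n k) x" .
  moreover have "block n x k = drop (offset n k) x"
    using Suc.prems by (simp add: block_def)
  ultimately show ?case by simp
qed simp

lemma in_grid_iff:
  assumes "\<And>i. i < k \<Longrightarrow> S i \<subseteq> cube (n i)"
  shows "x \<in> grid k S \<longleftrightarrow> length x = offset n k \<and> (\<forall>i<k. block n x i \<in> S i)"
proof
  assume "x \<in> grid k S"
  then obtain z where z: "x = concat (map z [0..<k])" "\<forall>i<k. z i \<in> S i"
    by (auto simp: grid_def)
  then have "\<And>i. i < k \<Longrightarrow> length (z i) = n i" using assms by (force simp: cube_def)
  then show "length x = offset n k \<and> (\<forall>i<k. block n x i \<in> S i)"
    using z length_concat_blocks[of k z n] block_concat[of k z n] by simp
next
  assume "length x = offset n k \<and> (\<forall>i<k. block n x i \<in> S i)"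
  then show "x \<in> grid k S"
    unfolding grid_def by (intro CollectI exI[of _ "block n x"]) (simp add: concat_block)
qed

lemma block_in_cube:
  assumes "x \<in> cube (offset n k)" "i < k"
  shows "block n x i \<in> cube (n i)"
proof -
  have "length (block n x i) = n i"
    using assms offset_Suc_le[OF assms(2), of n] by (simp add: cube_def block_def)
  moreover have "set (block n x i) \<subseteq> set x"
    unfolding block_def using set_take_subset set_drop_subset by (rule subset_trans)
  ultimately show ?thesis using assms(1) by (auto simp: cube_def)
qed

lemma grid_subset_cube:
  assumes "\<And>i. i < k \<Longrightarrow> S i \<subseteq> cube (n i)"
  shows "grid k S \<subseteq> cube (offset n k)"
proof
  fix x assume "x \<in> grid k S"
  then have x: "length x = offset n k" "\<And>i. i < k \<Longrightarrow> block n x i \<in> cube (n i)"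
    using in_grid_iff[of k S n x] assms by blast+
  have "set (concat (map (block n x) [0..<k])) \<subseteq> {0, 1}"
    using x(2) by (force simp: cube_def)
  then show "x \<in> cube (offset n k)" using x(1) concat_block by (simp add: cube_def)
qed

section \<open>Hamming weight and symmetric sets\<close>

lemma sum_eq_card_ones:
  fixes x :: "nat \<Rightarrow> real"
  assumes "finite A" "\<And>j. j \<in> A \<Longrightarrow> x j = 0 \<or> x j = 1"
  shows "(\<Sum>j\<in>A. x j) = real (card {j \<in> A. x j = 1})"
proof -
  have "(\<Sum>j\<in>A. x j) = (\<Sum>j\<in>A. if x j = 1 then 1 else 0)"
    using assms(2) by (intro sum.cong) auto
  then show ?thesis using assms(1) by (simp add: sum.If_cases Int_def)
qed

lemma cube_nth: "x \<in> cube n \<Longrightarrow> j < n \<Longrightarrow> x ! j = 0 \<or> x ! j = 1"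
  by (auto simp: cube_def dest: nth_mem)

lemma hamming_weight_eq_sum:
  assumes "z \<in> cube n"
  shows "real (hamming_weight z) = (\<Sum>j<n. z ! j)"
proof -
  have "length z = n" using assms by (simp add: cube_def)
  then show ?thesis
    using sum_eq_card_ones[of "{..<n}" "(!) z"] cube_nth[OF assms]
    by (simp add: hamming_weight_def)
qed

lemma hamming_weight_le: "z \<in> cube n \<Longrightarrow> hamming_weight z \<le> n"
  using card_mono[of "{..<n}" "{i. i < n \<and> z ! i = 1}"]
  by (auto simp: hamming_weight_def cube_def)

lemma hamming_weight_block:
  assumes "x \<in> cube (offset n k)" "i < k"
  shows "real (hamming_weight (block n x i)) = (\<Sum>j\<in>block_indices n i. x ! j)"
proof -
  have len: "length x = offset n k" using assms by (simp add: cube_def)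
  have "real (hamming_weight (block n x i)) = (\<Sum>j<n i. x ! (j + offset n i))"
    using hamming_weight_eq_sum[OF block_in_cube[OF assms]] offset_Suc_le[OF assms(2), of n] len
    by (simp add: block_def add.commute)
  also have "\<dots> = (\<Sum>j\<in>block_indices n i. x ! j)"
    unfolding block_indices_def
    by (rule sum.reindex_bij_witness[of _ "\<lambda>j. j - offset n i" "\<lambda>j. j + offset n i"]) auto
  finally show ?thesis .
qed

lemma hamming_weight_mset: "hamming_weight z = count (mset z) 1"
proof -
  have "hamming_weight z = card {i. i < length z \<and> 1 = z ! i}"
    unfolding hamming_weight_def by (rule arg_cong[where f = card]) auto
  then show ?thesis by (simp add: count_mset count_list_eq_length_filter length_filter_conv_card)
qed

text \<open>Two points of the cube with equal weight have the same multiset of entries, hence differ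
  by a permutation of the coordinates.\<close>

lemma symmetric_set_mem_iff:
  assumes "symmetric_set n S" "z \<in> cube n"
  shows "z \<in> S \<longleftrightarrow> hamming_weight z \<in> weight_set S"
proof
  assume "hamming_weight z \<in> weight_set S"
  then obtain y where y: "y \<in> S" "hamming_weight y = hamming_weight z"
    by (auto simp: weight_set_def)
  then have yc: "y \<in> cube n" using assms by (auto simp: symmetric_set_def)
  have size: "n = count (mset w) 0 + count (mset w) 1" if "w \<in> cube n" for w
  proof -
    have "set_mset (mset w) \<subseteq> {0, 1}" "size (mset w) = n" using that by (auto simp: cube_def)
    then show ?thesis unfolding size_multiset_overloaded_eq
      by (subst (asm) sum.mono_neutral_left[of "{0, 1}"]) (auto simp: not_in_iff)
  qed
  have "mset z = mset y"
  proof (rule multiset_eqI)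
    fix a :: real
    consider "a = 0" | "a = 1" | "a \<notin> {0, 1}" by blast
    then show "count (mset z) a = count (mset y) a"
    proof cases
      case 1
      then show ?thesis using size[OF yc] size[OF assms(2)] y(2) by (simp add: hamming_weight_mset)
    next
      case 2
      then show ?thesis using y(2) by (simp add: hamming_weight_mset)
    next
      case 3
      then have "a \<notin> set z" "a \<notin> set y" using yc assms(2) by (auto simp: cube_def)
      then show ?thesis by (metis count_eq_zero_iff set_mset_mset)
    qed
  qed
  then obtain p where "p permutes {..<length y}" "permute_list p y = z"
    by (rule mset_eq_permutation)
  then show "z \<in> S" using assms(1) y(1) yc by (auto simp: symmetric_set_def cube_def)
qed (auto simp: weight_set_def)

lemma weight_set_le: "S \<subseteq> cube n \<Longrightarrow> weight_set S \<subseteq> {..n}"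
  using hamming_weight_le by (auto simp: weight_set_def)

lemma weight_set_complement:
  assumes "symmetric_set n S"
  shows "weight_set (cube n - S) = {..n} - weight_set S"
proof
  show "weight_set (cube n - S) \<subseteq> {..n} - weight_set S"
    using symmetric_set_mem_iff[OF assms] hamming_weight_le by (auto simp: weight_set_def)
  show "{..n} - weight_set S \<subseteq> weight_set (cube n - S)"
  proof
    fix w assume w: "w \<in> {..n} - weight_set S"
    define z where "z = replicate w (1 :: real) @ replicate (n - w) 0"
    have "z \<in> cube n" "hamming_weight z = w"
      using w by (auto simp: z_def cube_def hamming_weight_mset)
    then show "w \<in> weight_set (cube n - S)"
      using w symmetric_set_mem_iff[OF assms] by (force simp: weight_set_def)
  qed
qed

text \<open>The complement contains all outer weights, so those of \<open>S\<close> lie between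
  \<open>\<mu>\<close> and \<open>n - \<mu>\<close>; by maximality of \<open>\<mu>\<close> one of
  these endpoints is attained. Nonemptiness excludes \<open>\<mu> = (n + 1) / 2\<close>. The last
  part counts the \<open>n + 1\<close> weights.\<close>

lemma mu_complement:
  assumes "symmetric_set n S" "S \<noteq> {}"
  shows "2 * mu n (cube n - S) \<le> n"
    and "weight_set S \<subseteq> {mu n (cube n - S)..n - mu n (cube n - S)}"
    and "mu n (cube n - S) \<in> weight_set S \<or> n - mu n (cube n - S) \<in> weight_set S"
    and "Lambda_bar n S + card (weight_set S) + mu n (cube n - S) = n + 1"
proof -
  let ?W = "weight_set S" and ?\<mu> = "mu n (cube n - S)"
  let ?A = "{i. i \<le> nat \<lceil>real n / 2\<rceil> \<and> outer_weights n i \<subseteq> weight_set (cube n - S)}"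
  have W: "?W \<subseteq> {..n}" "?W \<noteq> {}"
    using assms weight_set_le[of S n] by (auto simp: symmetric_set_def weight_set_def)
  have fin: "finite ?A" by (rule finite_subset[of _ "{..nat \<lceil>real n / 2\<rceil>}"]) auto
  have "0 \<in> ?A" by (simp add: outer_weights_def)
  then have "?\<mu> \<in> ?A" unfolding mu_def using fin by (intro Max_in) auto
  then have outer: "outer_weights n ?\<mu> \<inter> ?W = {}"
    using weight_set_complement[OF assms(1)] by auto
  show range: "?W \<subseteq> {?\<mu>..n - ?\<mu>}"
  proof
    fix w assume "w \<in> ?W"
    then have "w \<le> n" "w \<notin> outer_weights n ?\<mu>" using outer W(1) by auto
    then show "w \<in> {?\<mu>..n - ?\<mu>}" by (auto simp: outer_weights_def)
  qed
  then show le: "2 * ?\<mu> \<le> n" using W(2) by (cases "2 * ?\<mu> \<le> n") auto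
  show "?\<mu> \<in> ?W \<or> n - ?\<mu> \<in> ?W"
  proof (rule ccontr)
    assume not: "\<not> ?thesis"
    \<comment> \<open>For \<open>n = 2 * \<mu>\<close> the index \<open>\<mu> + 1\<close> would
      exceed the cap in \<open>mu\<close>, so maximality would say nothing; this case is excluded
      directly.\<close>
    have "2 * ?\<mu> \<noteq> n"
    proof
      assume "2 * ?\<mu> = n"
      then have "n - ?\<mu> = ?\<mu>" by simp
      then have "?W \<subseteq> {?\<mu>}" using range by simp
      then show False using not W(2) by auto
    qed
    then have "?\<mu> + 1 \<le> nat \<lceil>real n / 2\<rceil>" using le by linarith
    moreover have "w \<notin> ?W \<and> w \<le> n" if "w \<in> outer_weights n (?\<mu> + 1)" for w
    proof -
      have "w \<in> outer_weights n ?\<mu> \<or> w = ?\<mu> \<or> w = n - ?\<mu>"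
        using that le by (auto simp: outer_weights_def)
      moreover have "w \<le> n" using that le by (auto simp: outer_weights_def)
      ultimately show ?thesis using outer not by auto
    qed
    ultimately have "?\<mu> + 1 \<in> ?A" using weight_set_complement[OF assms(1)] by auto
    then have "?\<mu> + 1 \<le> ?\<mu>" using fin Max_ge[of ?A "?\<mu> + 1"] unfolding mu_def by simp
    then show False by simp
  qed
  have "card ({..n} - ?W) = n + 1 - card ?W"
    using W(1) finite_subset[OF W(1)] by (subst card_Diff_subset) auto
  moreover have "card ?W \<le> n + 1" using card_mono[OF _ W(1)] by simp
  moreover have "?\<mu> \<le> card (weight_set (cube n - S))" by (rule mu_le_card) auto
  ultimately show "Lambda_bar n S + card ?W + ?\<mu> = n + 1"
    unfolding Lambda_bar_def Lambda_def weight_set_complement[OF assms(1)] by linarith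
qed

section \<open>The lower bound\<close>

definition flip :: "(nat \<Rightarrow> real) \<Rightarrow> nat set \<Rightarrow> nat \<Rightarrow> real" where
  "flip y U j = (if j \<in> U then 1 - y j else y j)"

lemma sum_Pow_insert_alternating:
  fixes g :: "'a set \<Rightarrow> real"
  assumes "finite F" "i \<notin> F"
  shows "(\<Sum>U\<in>Pow (insert i F). (- 1) ^ card U * g U) =
    (\<Sum>U\<in>Pow F. (- 1) ^ card U * (g U - g (insert i U)))"
proof -
  have inj: "inj_on (insert i) (Pow F)"
    using assms(2) by (auto simp: inj_on_def)
  have card: "card (insert i U) = Suc (card U)" if "U \<in> Pow F" for U
    using that assms finite_subset[of U F] by (subst card_insert_disjoint) auto
  have "(\<Sum>U\<in>Pow (insert i F). (- 1) ^ card U * g U) =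
      (\<Sum>U\<in>Pow F. (- 1) ^ card U * g U) + (\<Sum>U\<in>insert i ` Pow F. (- 1) ^ card U * g U)"
    unfolding Pow_insert by (rule sum.union_disjoint) (use assms in auto)
  also have "(\<Sum>U\<in>insert i ` Pow F. (- 1) ^ card U * g U) = (\<Sum>U\<in>Pow F. - ((- 1) ^ card U * g (insert i U)))"
    unfolding sum.reindex[OF inj] by (rule sum.cong) (auto simp: card)
  finally show ?thesis by (simp add: sum_negf sum_subtractf right_diff_distrib)
qed

text \<open>An iterated difference in more directions than the degree vanishes. Consequently a
  function that is nonzero at only one vertex of a subcube has degree at least its
  dimension.\<close>

lemma alternating_sum_eq_0:
  assumes "fun_degree_le d f" "finite F" "d < card F"
  shows "(\<Sum>U\<in>Pow F. (- 1) ^ card U * f (flip y U)) = 0"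
  using assms
proof (induction arbitrary: F y rule: fun_degree_le.induct)
  case (const d c)
  then obtain i where i: "i \<in> F" by fastforce
  show ?case
    using sum_Pow_insert_alternating[of "F - {i}" i "\<lambda>_. c"] const i by (simp add: insert_absorb)
next
  case (coord d f i)
  show ?case
  proof (cases "i \<in> F")
    case False
    then have "(\<Sum>U\<in>Pow F. (- 1) ^ card U * (flip y U i * f (flip y U))) =
        (\<Sum>U\<in>Pow F. y i * ((- 1) ^ card U * f (flip y U)))"
      by (intro sum.cong) (auto simp: flip_def)
    also have "\<dots> = y i * (\<Sum>U\<in>Pow F. (- 1) ^ card U * f (flip y U))"
      by (rule sum_distrib_left[symmetric])
    finally show ?thesis using coord.IH[of F y] coord.prems by simp
  next
    case True
    \<comment> \<open>Pairing \<open>U\<close> with \<open>insert i U\<close> fixes the coordinate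
      factor to \<open>y i\<close> or \<open>1 - y i\<close>. What remains are alternating sums over
      one direction fewer, based at \<open>y\<close> and at \<open>?y\<close>.\<close>
    let ?F = "F - {i}" and ?y = "y(i := 1 - y i)"
    have F: "finite ?F" "d < card ?F" using coord.prems True by auto
    have flips: "flip y U i = y i" "flip ?y U i = 1 - y i" "flip y (insert i U) = flip ?y U"
      if "U \<in> Pow ?F" for U
      using that by (auto simp: flip_def fun_eq_iff)
    have "(\<Sum>U\<in>Pow F. (- 1) ^ card U * (flip y U i * f (flip y U))) =
        (\<Sum>U\<in>Pow ?F. (- 1) ^ card U * (flip y U i * f (flip y U) - flip y (insert i U) i * f (flip y (insert i U))))"
      using sum_Pow_insert_alternating[of ?F i "\<lambda>U. flip y U i * f (flip y U)"] F(1) True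
      by (simp add: insert_absorb)
    also have "\<dots> = (\<Sum>U\<in>Pow ?F. y i * ((- 1) ^ card U * f (flip y U)) -
        (1 - y i) * ((- 1) ^ card U * f (flip ?y U)))"
      by (rule sum.cong[OF refl]) (simp only: flips, simp add: algebra_simps)
    also have "\<dots> = y i * (\<Sum>U\<in>Pow ?F. (- 1) ^ card U * f (flip y U)) -
        (1 - y i) * (\<Sum>U\<in>Pow ?F. (- 1) ^ card U * f (flip ?y U))"
      by (simp only: sum_subtractf sum_distrib_left)
    finally show ?thesis using coord.IH[OF F, of y] coord.IH[OF F, of ?y] by simp
  qed
next
  case (add d f g)
  then show ?case by (simp add: distrib_left sum.distrib)
qed

lemma fun_degree_le_affine_mult:
  assumes "fun_degree_le d f"
  shows "fun_degree_le (Suc d) (\<lambda>x. ((\<Sum>j\<in>B. x j) - c) * f x)"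
proof -
  have "fun_degree_le (Suc d) (\<lambda>x. (\<Sum>j\<in>B. x j * f x) + (- c) * f x)"
    using assms
    by (intro fun_degree_le.add fun_degree_le_sum fun_degree_le.coord fun_degree_le_scale)
      (auto intro: fun_degree_le_mono)
  then show ?thesis by (simp add: sum_distrib_right left_diff_distrib)
qed

lemma fun_degree_le_affine_prod:
  assumes "fun_degree_le d f" "finite V"
  shows "fun_degree_le (d + card V) (\<lambda>x. (\<Prod>w\<in>V. (\<Sum>j\<in>B. x j) - c w) * f x)"
  using assms(2)
proof (induction V rule: finite_induct)
  case (insert w V)
  show ?case
    using fun_degree_le_affine_mult[OF insert.IH, of B "c w"] insert.hyps by (simp add: mult.assoc)
qed (use assms in simp)

lemma fun_degree_le_affine_prods:
  fixes V :: "nat \<Rightarrow> 'w set" and k :: nat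
  assumes "fun_degree_le d f"
  shows "(\<And>i. i < k \<Longrightarrow> finite (V i)) \<Longrightarrow>
    fun_degree_le (d + (\<Sum>i<k. card (V i))) (\<lambda>x. (\<Prod>i<k. \<Prod>w\<in>V i. (\<Sum>j\<in>B i. x j) - c i w) * f x)"
proof (induction k)
  case (Suc k)
  then have "fun_degree_le (d + (\<Sum>i<k. card (V i))) (\<lambda>x. (\<Prod>i<k. \<Prod>w\<in>V i. (\<Sum>j\<in>B i. x j) - c i w) * f x)"
    by simp
  from fun_degree_le_affine_prod[OF this, of "V k" "B k" "c k"] show ?case
    using Suc.prems by (simp add: mult.assoc mult.left_commute add.assoc)
qed (use assms in simp)

section \<open>Degree bound for functions supported on a grid\<close>

lemma block_indices_subset: "i < k \<Longrightarrow> block_indices n i \<subseteq> {..<offset n k}"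
  using offset_mono[of "Suc i" k n] by (auto simp: block_indices_def)

lemma block_indices_disjoint: "i \<noteq> i' \<Longrightarrow> block_indices n i \<inter> block_indices n i' = {}"
  using offset_mono[of "Suc i" i' n] offset_mono[of "Suc i'" i n]
  by (cases i i' rule: linorder_cases) (auto simp: block_indices_def)

lemma in_grid_iff_weights:
  assumes "\<And>i. i < k \<Longrightarrow> symmetric_set (n i) (S i)" "x \<in> cube (offset n k)"
  shows "x \<in> grid k S \<longleftrightarrow> (\<forall>i<k. hamming_weight (block n x i) \<in> weight_set (S i))"
proof -
  have "x \<in> grid k S \<longleftrightarrow> (\<forall>i<k. block n x i \<in> S i)"
    using in_grid_iff[of k S n x] assms by (simp add: symmetric_set_def cube_def)
  then show ?thesis
    using symmetric_set_mem_iff assms(1) block_in_cube[OF assms(2)] by blast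
qed

text \<open>
  Every block of \<open>y\<close> has one of the two extreme weights \<open>\<mu>\<close>, \<open>n - \<mu>\<close>; the coordinates that are
  free to vary are its zeros in the first case and its ones in the second, so that the weight of
  the block changes monotonically. Multiplying \<open>f\<close> by the linear factors that exclude the
  remaining weights of \<open>S\<close> yields a multiple of the indicator function of \<open>y\<close> on the resulting
  subcube.
\<close>

lemma Lambda_bar_sum_le:
  assumes sym: "\<And>i. i < k \<Longrightarrow> symmetric_set (n i) (S i)" and ne: "\<And>i. i < k \<Longrightarrow> S i \<noteq> {}"
    and f: "fun_degree_le d f" "\<And>x x'. (\<And>i. i < offset n k \<Longrightarrow> x i = x' i) \<Longrightarrow> f x = f x'"
    and zero: "\<And>a. a \<in> cube (offset n k) - grid k S \<Longrightarrow> f ((!) a) = 0"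
    and y: "y \<in> grid k S" "f ((!) y) \<noteq> 0"
    and extreme: "\<And>i. i < k \<Longrightarrow> hamming_weight (block n y i) = mu (n i) (cube (n i) - S i) \<or>
      hamming_weight (block n y i) = n i - mu (n i) (cube (n i) - S i)"
  shows "(\<Sum>i<k. Lambda_bar (n i) (S i)) \<le> d"
proof -
  let ?N = "offset n k" and ?w = "\<lambda>x i. hamming_weight (block n x i)" and ?W = "\<lambda>i. weight_set (S i)"
  let ?\<mu> = "\<lambda>i. mu (n i) (cube (n i) - S i)" and ?B = "block_indices n"
  define V where "V i = ?W i - {?w y i}" for i
  \<comment> \<open>The common value in \<open>y\<close> of the coordinates that may be flipped. If
    \<open>n i = 2 * \<mu>\<close>, both extremes coincide and the zeros are taken.\<close>
  define free where "free i = (if ?w y i = ?\<mu> i then 0 else 1 :: real)" for i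
  define F where "F i = {j \<in> ?B i. y ! j = free i}" for i
  define h where "h x = (\<Prod>i<k. \<Prod>w\<in>V i. (\<Sum>j\<in>?B i. x j) - real w) * f x" for x
  have sub: "S i \<subseteq> cube (n i)" if "i < k" for i using sym[OF that] by (simp add: symmetric_set_def)
  have yc: "y \<in> cube ?N" using y(1) grid_subset_cube[of k S n] sub by blast
  have wy: "?w y i \<in> ?W i" if "i < k" for i
    using in_grid_iff_weights[OF sym yc] y(1) that by blast
  have fin: "finite (?W i)" if "i < k" for i
    using finite_subset[OF weight_set_le[OF sub[OF that]]] by simp
  have y01: "y ! j = 0 \<or> y ! j = 1" if "j \<in> ?B i" "i < k" for i j
    using cube_nth[OF yc] block_indices_subset[OF that(2), of n] that(1) by auto
  have card_ones: "card {j \<in> ?B i. y ! j = 1} = ?w y i" if "i < k" for i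
    using sum_eq_card_ones[of "?B i" "(!) y"] hamming_weight_block[OF yc that] y01 that
    by (simp add: block_indices_def)
  have card_F: "card (F i) = n i - ?\<mu> i" if "i < k" for i
  proof (cases "?w y i = ?\<mu> i")
    case True
    have "F i = ?B i - {j \<in> ?B i. y ! j = 1}"
      using True y01[OF _ that] by (auto simp: F_def free_def)
    moreover have "card (?B i - {j \<in> ?B i. y ! j = 1}) = card (?B i) - card {j \<in> ?B i. y ! j = 1}"
      by (rule card_Diff_subset) (auto simp: block_indices_def)
    ultimately show ?thesis
      using True card_ones[OF that] by (simp add: block_indices_def)
  next
    case False
    then show ?thesis using card_ones[OF that] extreme[OF that] by (simp add: F_def free_def)
  qed
  \<comment> \<open>The count that decides the bound: the \<open>n i - \<mu>\<close> free
    coordinates are as many as \<open>Lambda_bar\<close> and the excluded weights together.\<close>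
  have card: "Lambda_bar (n i) (S i) + card (V i) = card (F i)" if "i < k" for i
  proof -
    have "card (V i) = card (?W i) - 1" "card (?W i) \<noteq> 0"
      using wy[OF that] fin[OF that] by (auto simp: V_def)
    then show ?thesis
      using mu_complement[OF sym ne, OF that that] card_F[OF that] by linarith
  qed
  have "fun_degree_le (d + (\<Sum>i<k. card (V i))) h"
    unfolding h_def using fin by (intro fun_degree_le_affine_prods f(1)) (simp add: V_def)
  moreover have "finite (\<Union>i<k. F i)" by (simp add: F_def block_indices_def)
  moreover have "(\<Sum>U\<in>Pow (\<Union>i<k. F i). (- 1) ^ card U * h (flip ((!) y) U)) \<noteq> 0"
  proof -
    have "h (flip ((!) y) U) = 0" if U: "U \<subseteq> (\<Union>i<k. F i)" "U \<noteq> {}" for U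
    proof -
      define a where "a = map (flip ((!) y) U) [0..<?N]"
      have "flip ((!) y) U j = 0 \<or> flip ((!) y) U j = 1" if "j < ?N" for j
        using cube_nth[OF yc that] by (auto simp: flip_def)
      then have ac: "a \<in> cube ?N" by (fastforce simp: a_def cube_def)
      have aw: "real (?w a i) = (\<Sum>j\<in>?B i. flip ((!) y) U j)" if "i < k" for i
        unfolding hamming_weight_block[OF ac that]
        using block_indices_subset[OF that, of n] by (intro sum.cong) (auto simp: a_def)
      obtain i j where ij: "i < k" "j \<in> F i" "j \<in> U" using U by blast
      have UB: "U \<inter> ?B i \<subseteq> F i"
      proof
        fix j assume j: "j \<in> U \<inter> ?B i"
        then obtain i' where "i' < k" "j \<in> F i'" using U by blast
        then show "j \<in> F i"
          using j block_indices_disjoint[of i i' n] by (cases "i = i'") (auto simp: F_def)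
      qed
      \<comment> \<open>All flipped coordinates of the block have the same value in
        \<open>y\<close>, so each changes the weight by the same sign and nothing cancels.\<close>
      have "(\<Sum>j\<in>?B i. flip ((!) y) U j) - (\<Sum>j\<in>?B i. y ! j) = (\<Sum>j\<in>?B i. if j \<in> U then 1 - 2 * free i else 0)"
        unfolding sum_subtractf[symmetric]
        by (rule sum.cong) (use UB in \<open>auto simp: flip_def F_def\<close>)
      also have "\<dots> = real (card (?B i \<inter> U)) * (1 - 2 * free i)"
        by (simp add: sum.If_cases block_indices_def)
      also have "\<dots> \<noteq> 0"
      proof -
        have "j \<in> ?B i \<inter> U" using ij by (simp add: F_def)
        then have "card (?B i \<inter> U) \<noteq> 0" by (auto simp: block_indices_def)
        then show ?thesis by (simp add: free_def)
      qed
      finally have neq: "?w a i \<noteq> ?w y i"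
        using aw[OF ij(1)] hamming_weight_block[OF yc ij(1)] by auto
      \<comment> \<open>On the grid the changed weight is an excluded one and kills a linear factor;
        off the grid \<open>f\<close> itself vanishes.\<close>
      show ?thesis
      proof (cases "a \<in> grid k S")
        case True
        then have "?w a i \<in> V i"
          using in_grid_iff_weights[OF sym ac] ij(1) neq by (auto simp: V_def)
        then have "(\<Prod>w\<in>V i. (\<Sum>j\<in>?B i. flip ((!) y) U j) - real w) = 0"
          using aw[OF ij(1)] fin[OF ij(1)] by (intro prod_zero bexI[of _ "?w a i"]) (auto simp: V_def)
        then have "(\<Prod>i<k. \<Prod>w\<in>V i. (\<Sum>j\<in>?B i. flip ((!) y) U j) - real w) = 0"
          using ij(1) by (auto simp: prod_zero_iff)
        then show ?thesis by (simp add: h_def)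
      next
        case False
        then have "f ((!) a) = 0" using zero ac by blast
        moreover have "f (flip ((!) y) U) = f ((!) a)" by (rule f(2)) (simp add: a_def)
        ultimately show ?thesis by (simp add: h_def)
      qed
    qed
    then have "(\<Sum>U\<in>Pow (\<Union>i<k. F i). (- 1) ^ card U * h (flip ((!) y) U)) =
        (\<Sum>U\<in>{{}}. (- 1) ^ card U * h (flip ((!) y) U))"
      by (intro sum.mono_neutral_right) (auto simp: F_def block_indices_def)
    also have "\<dots> = h ((!) y)" by (simp add: flip_def[abs_def])
    also have "\<dots> \<noteq> 0"
    proof -
      have "(\<Sum>j\<in>?B i. y ! j) - real w \<noteq> 0" if "i < k" "w \<in> V i" for i w
        using that hamming_weight_block[OF yc that(1)] by (auto simp: V_def)
      then show ?thesis using y(2) fin by (simp add: h_def V_def)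
    qed
    finally show ?thesis .
  qed
  ultimately have "card (\<Union>i<k. F i) \<le> d + (\<Sum>i<k. card (V i))"
    using alternating_sum_eq_0[of _ h "\<Union>i<k. F i" "(!) y"] by (meson not_le)
  moreover have "card (\<Union>i<k. F i) = (\<Sum>i<k. card (F i))"
  proof (rule card_UN_disjoint)
    show "\<forall>i\<in>{..<k}. \<forall>j\<in>{..<k}. i \<noteq> j \<longrightarrow> F i \<inter> F j = {}"
      using block_indices_disjoint unfolding F_def by blast
  qed (auto simp: F_def block_indices_def)
  moreover have "(\<Sum>i<k. card (F i)) = (\<Sum>i<k. Lambda_bar (n i) (S i)) + (\<Sum>i<k. card (V i))"
    using card by (simp add: sum.distrib[symmetric])
  ultimately show ?thesis by simp
qed

lemma grid_eq_empty_iff: "grid k S = {} \<longleftrightarrow> (\<exists>i<k. S i = {})"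
proof
  assume "grid k S = {}"
  show "\<exists>i<k. S i = {}"
  proof (rule ccontr)
    assume "\<not> ?thesis"
    then have "\<forall>i<k. (SOME x. x \<in> S i) \<in> S i" by (simp add: some_in_eq)
    then show False using \<open>grid k S = {}\<close> by (auto simp: grid_def)
  qed
qed (auto simp: grid_def)

text \<open>The point \<open>y\<close> is assembled from members of extreme weight in every block.
  Its multiplicity is exactly \<open>l\<close>, so a reduced function is nonzero there while it
  vanishes off the grid.\<close>

lemma EPC_grid_ge:
  assumes sym: "\<And>i. i < k \<Longrightarrow> symmetric_set (n i) (S i)" and ne: "grid k S \<noteq> {}"
  shows "enat ((\<Sum>i<k. Lambda_bar (n i) (S i)) + 2 * l) \<le>
    EPC (offset n k) (Suc l) l (cube (offset n k) - grid k S)"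
  unfolding EPC_def
proof (rule INF_greatest)
  let ?N = "offset n k" and ?\<mu> = "\<lambda>i. mu (n i) (cube (n i) - S i)"
  fix P assume "P \<in> {P. exact_polynomial_cover ?N (Suc l) l (cube ?N - grid k S) P}"
  then have P: "poly_in_vars ?N P" "P \<noteq> 0" "\<And>a. a \<in> cube ?N - grid k S \<Longrightarrow> Suc l \<le> mult_at ?N P a"
    "\<And>b. b \<in> cube ?N \<Longrightarrow> b \<in> grid k S \<Longrightarrow> mult_at ?N P b = l"
    by (auto simp: exact_polynomial_cover_def)
  note iff = mult_at_ge_iff[OF P(1,2)]
  have sub: "S i \<subseteq> cube (n i)" if "i < k" for i using sym[OF that] by (simp add: symmetric_set_def)
  have nei: "S i \<noteq> {}" if "i < k" for i using ne that unfolding grid_eq_empty_iff by blast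
  have "\<exists>z. z \<in> S i \<and> (hamming_weight z = ?\<mu> i \<or> hamming_weight z = n i - ?\<mu> i)" if "i < k" for i
    using mu_complement(3)[OF sym nei, OF that that] by (auto simp: weight_set_def)
  then obtain z where z: "\<And>i. i < k \<Longrightarrow> z i \<in> S i"
    "\<And>i. i < k \<Longrightarrow> hamming_weight (z i) = ?\<mu> i \<or> hamming_weight (z i) = n i - ?\<mu> i"
    by metis
  define y where "y = concat (map z [0..<k])"
  have y: "y \<in> grid k S" using z(1) by (auto simp: y_def grid_def)
  then have yc: "y \<in> cube ?N" using grid_subset_cube[of k S n] sub by blast
  have len: "length (z i) = n i" if "i < k" for i using z(1)[OF that] sub[OF that] by (auto simp: cube_def)
  have yb: "block n y i = z i" if "i < k" for i
    unfolding y_def by (rule block_concat) (use len that in auto)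
  have nm: "\<not> mult_at_least ?N P y (Suc l)" using P(4)[OF yc y] iff[of "Suc l" y] by simp
  have am: "mult_at_least ?N P a l" if "a \<in> cube ?N" for a
  proof (cases "a \<in> grid k S")
    case True
    then show ?thesis using P(4)[OF that] iff[of l a] by simp
  next
    case False
    then have "Suc l \<le> mult_at ?N P a" using P(3) that by blast
    then show ?thesis using iff[of l a] by simp
  qed
  obtain f d where fd: "fun_degree_le d f" "d + 2 * l \<le> total_degree P" "f ((!) y) \<noteq> 0"
    "\<forall>a\<in>cube ?N. mult_at_least ?N P a (Suc l) \<longrightarrow> f ((!) a) = 0"
    "\<forall>x x'. (\<forall>i<?N. x i = x' i) \<longrightarrow> f x = f x'"
    using ex_reduced_function[OF P(1) am yc nm] by blast
  have "(\<Sum>i<k. Lambda_bar (n i) (S i)) \<le> d"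
  proof (rule Lambda_bar_sum_le[OF sym nei fd(1) _ _ y fd(3)])
    show "f x = f x'" if "\<And>i. i < ?N \<Longrightarrow> x i = x' i" for x x'
      by (rule fd(5)[rule_format]) (rule that)
    show "f ((!) a) = 0" if "a \<in> cube ?N - grid k S" for a
      using fd(4) P(3)[OF that] that unfolding iff by blast
    show "hamming_weight (block n y i) = ?\<mu> i \<or> hamming_weight (block n y i) = n i - ?\<mu> i" if "i < k" for i
      using z(2)[OF that] yb[OF that] by simp
  qed
  then show "enat ((\<Sum>i<k. Lambda_bar (n i) (S i)) + 2 * l) \<le> enat (total_degree P)"
    using fd(2) by simp
qed

section \<open>The upper bound\<close>

text \<open>The entry at \<open>j\<close> is the number \<open>c\<close> with
  \<open>c + (m - \<mu>) = \<mu> - 1 - j\<close>: setting the coordinate to 1 moves the required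
  tail weight from \<open>\<mu> - 1 - j\<close> to \<open>m - \<mu>\<close>. For
  \<open>2 * \<mu> \<le> m\<close> it is negative.\<close>

definition outer_coeff :: "nat \<Rightarrow> nat \<Rightarrow> nat \<Rightarrow> nat \<Rightarrow> real" where
  "outer_coeff m \<mu> j l = (if l < j then 0 else if l = j then 2 * real \<mu> - real m - real j - 1 else 1)"

text \<open>
  The \<open>j\<close>-th hyperplane contains \<open>z\<close> iff the weight of \<open>z\<close> after position \<open>j\<close> is \<open>\<mu> - 1 - j\<close> with
  \<open>z\<^sub>j = 0\<close>, or \<open>m - \<mu>\<close> with \<open>z\<^sub>j = 1\<close>. For outer weights such a \<open>j\<close> exists because the tail
  weights change in steps of at most one.
\<close>

lemma outer_weight_iff:
  assumes "z \<in> cube m" "2 * \<mu> \<le> m"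
  shows "(\<exists>j<\<mu>. (\<Sum>l<m. outer_coeff m \<mu> j l * z ! l) = real \<mu> - 1 - real j) \<longleftrightarrow>
    hamming_weight z < \<mu> \<or> m - \<mu> < hamming_weight z"
proof -
  define b where "b l = (if z ! l = 1 then 1 else 0 :: nat)" for l
  define r where "r j = (\<Sum>l=j..<m. b l)" for j
  have zb: "z ! l = real (b l)" if "l < m" for l
    using cube_nth[OF assms(1) that] by (auto simp: b_def)
  have b1: "b l \<le> 1" for l by (simp add: b_def)
  have r_Suc: "r j = b j + r (Suc j)" if "j < m" for j
    unfolding r_def using that by (rule sum.atLeast_Suc_lessThan)
  have r_le: "r j \<le> m - j" for j
    using sum_mono[of "{j..<m}" b "\<lambda>_. 1"] b1 by (simp add: r_def)
  have "real (hamming_weight z) = real (r 0)"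
    unfolding hamming_weight_eq_sum[OF assms(1)] r_def by (simp add: zb atLeast0LessThan)
  then have w: "hamming_weight z = r 0" by simp
  have eq: "(\<Sum>l<m. outer_coeff m \<mu> j l * z ! l) =
      real (r (Suc j)) - (real m + 1 + real j - 2 * real \<mu>) * real (b j)" if "j < m" for j
  proof -
    have "{..<m} = {..<j} \<union> insert j {Suc j..<m}" using that by auto
    moreover have "{..<j} \<inter> insert j {Suc j..<m} = {}" by auto
    ultimately have "(\<Sum>l<m. outer_coeff m \<mu> j l * z ! l) =
        (\<Sum>l<j. outer_coeff m \<mu> j l * z ! l) + (\<Sum>l\<in>insert j {Suc j..<m}. outer_coeff m \<mu> j l * z ! l)"
      by (metis sum.union_disjoint finite_lessThan finite_atLeastLessThan finite_insert)
    also have "(\<Sum>l<j. outer_coeff m \<mu> j l * z ! l) = 0"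
      by (rule sum.neutral) (simp add: outer_coeff_def)
    also have "(\<Sum>l\<in>insert j {Suc j..<m}. outer_coeff m \<mu> j l * z ! l) =
        outer_coeff m \<mu> j j * z ! j + (\<Sum>l=Suc j..<m. outer_coeff m \<mu> j l * z ! l)"
      by simp
    also have "(\<Sum>l=Suc j..<m. outer_coeff m \<mu> j l * z ! l) = real (r (Suc j))"
      by (simp add: r_def outer_coeff_def zb)
    finally show ?thesis using zb[OF that] by (simp add: outer_coeff_def algebra_simps)
  qed
  show ?thesis
  proof
    assume "\<exists>j<\<mu>. (\<Sum>l<m. outer_coeff m \<mu> j l * z ! l) = real \<mu> - 1 - real j"
    then obtain j where j: "j < \<mu>" "(\<Sum>l<m. outer_coeff m \<mu> j l * z ! l) = real \<mu> - 1 - real j"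
      by blast
    then have jm: "j < m" using assms(2) by simp
    \<comment> \<open>The head before position \<open>j\<close> weighs between 0 and
      \<open>j\<close>. With \<open>b j = 0\<close> the total is thus at most
      \<open>\<mu> - 1\<close>, with \<open>b j = 1\<close> at least
      \<open>m - \<mu> + 1\<close>.\<close>
    have split: "r 0 = (\<Sum>l<j. b l) + b j + r (Suc j)"
      using sum.atLeastLessThan_concat[of 0 j m b] jm r_Suc[OF jm] by (simp add: r_def atLeast0LessThan)
    have "(\<Sum>l<j. b l) \<le> j" using sum_mono[of "{..<j}" b "\<lambda>_. 1"] b1 by simp
    moreover have "b j = 0 \<or> b j = 1" by (simp add: b_def)
    ultimately show "hamming_weight z < \<mu> \<or> m - \<mu> < hamming_weight z"
    proof (elim disjE)
      assume "b j = 0" "(\<Sum>l<j. b l) \<le> j"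
      then show ?thesis using j(2) split j(1) unfolding eq[OF jm] w by simp
    next
      assume "b j = 1"
      then show ?thesis using j(2) split assms(2) unfolding eq[OF jm] w by simp
    qed
  next
    assume "hamming_weight z < \<mu> \<or> m - \<mu> < hamming_weight z"
    then show "\<exists>j<\<mu>. (\<Sum>l<m. outer_coeff m \<mu> j l * z ! l) = real \<mu> - 1 - real j"
    proof
      assume "hamming_weight z < \<mu>"
      \<comment> \<open>First crossing of \<open>r j + j\<close>, which grows by 0 or 1 and is at
        least \<open>\<mu>\<close> at index \<open>\<mu>\<close>; it grows only where
        \<open>b j = 0\<close>.\<close>
      then obtain j where j: "j < \<mu>" "r j + j < \<mu>" "\<mu> \<le> r (Suc j) + Suc j"
        using ex_least_nat_less[of "\<lambda>j. \<mu> \<le> r j + j" \<mu>] w by force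
      then have jm: "j < m" using assms(2) by simp
      have "b j = 0" "r (Suc j) + j + 1 = \<mu>" using j r_Suc[OF jm] by linarith+
      then show ?thesis using j(1) eq[OF jm] by (intro exI[of _ j]) auto
    next
      assume "m - \<mu> < hamming_weight z"
      \<comment> \<open>First crossing of \<open>r j\<close>, which drops by 0 or 1 and is at most
        \<open>m - \<mu>\<close> at index \<open>\<mu>\<close>; it drops only where
        \<open>b j = 1\<close>.\<close>
      then obtain j where j: "j < \<mu>" "m - \<mu> < r j" "r (Suc j) \<le> m - \<mu>"
        using ex_least_nat_less[of "\<lambda>j. r j \<le> m - \<mu>" \<mu>] w r_le[of \<mu>] by force
      then have jm: "j < m" using assms(2) by simp
      have "b j = 1" "r (Suc j) = m - \<mu>" using j r_Suc[OF jm] b1[of j] by linarith+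
      then show ?thesis using j(1) eq[OF jm] assms(2) by (intro exI[of _ j]) (auto simp: of_nat_diff)
    qed
  qed
qed

text \<open>One layer for each missing weight between \<open>\<mu>\<close> and
  \<open>m - \<mu>\<close>, and \<open>\<mu>\<close> hyperplanes for the \<open>2 * \<mu>\<close>
  weights outside; the total is \<open>m + 1 - \<mu>\<close> minus the number of weights of
  \<open>S\<close>. Pairs of coefficients and constant are kept so that they can be moved to any
  block.\<close>

lemma ex_block_cover:
  assumes "symmetric_set m S" "S \<noteq> {}" "m \<ge> 1"
  shows "\<exists>Q :: ((nat \<Rightarrow> real) \<times> real) multiset. size Q = Lambda_bar m S \<and>
    (\<forall>p\<in>#Q. \<exists>l<m. fst p l \<noteq> 0) \<and>
    (\<forall>z\<in>cube m. z \<in> S \<longleftrightarrow> (\<forall>p\<in>#Q. (\<Sum>l<m. fst p l * z ! l) \<noteq> snd p))"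
proof -
  let ?\<mu> = "mu m (cube m - S)" and ?W = "weight_set S"
  note mu = mu_complement[OF assms(1,2)]
  let ?layer = "\<lambda>w. (\<lambda>_. 1 :: real, real w)"
  let ?outer = "\<lambda>j. (outer_coeff m ?\<mu> j, real ?\<mu> - 1 - real j)"
  define Q where "Q = image_mset ?layer (mset_set ({?\<mu>..m - ?\<mu>} - ?W)) + image_mset ?outer (mset_set {..<?\<mu>})"
  have Q_ball: "(\<forall>p\<in>#Q. R p) \<longleftrightarrow> (\<forall>w\<in>{?\<mu>..m - ?\<mu>} - ?W. R (?layer w)) \<and> (\<forall>j<?\<mu>. R (?outer j))" for R
    by (auto simp: Q_def)
  have finW: "finite ?W" using mu(2) by (rule finite_subset) simp
  have card: "card ({?\<mu>..m - ?\<mu>} - ?W) = (m - ?\<mu> + 1 - ?\<mu>) - card ?W" "card ?W \<le> m - ?\<mu> + 1 - ?\<mu>"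
    using card_Diff_subset[OF finW mu(2)] card_mono[OF _ mu(2)] by simp_all
  have "size Q = Lambda_bar m S"
    using card mu(1,4) by (simp add: Q_def)
  moreover have "\<exists>l<m. fst p l \<noteq> 0" if "p \<in># Q" for p
  proof -
    consider "fst p = (\<lambda>_. 1)" | j where "j < ?\<mu>" "fst p = outer_coeff m ?\<mu> j"
      using \<open>p \<in># Q\<close> by (auto simp: Q_def)
    then show ?thesis
    proof cases
      case 1
      then show ?thesis using assms(3) by (intro exI[of _ 0]) simp
    next
      case 2
      then have "j < m" "fst p j \<noteq> 0" using mu(1) by (auto simp: outer_coeff_def)
      then show ?thesis by blast
    qed
  qed
  moreover have "z \<in> S \<longleftrightarrow> (\<forall>p\<in>#Q. (\<Sum>l<m. fst p l * z ! l) \<noteq> snd p)" if z: "z \<in> cube m" for z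
  proof -
    have "(\<forall>p\<in>#Q. (\<Sum>l<m. fst p l * z ! l) \<noteq> snd p) \<longleftrightarrow>
        (\<forall>w\<in>{?\<mu>..m - ?\<mu>} - ?W. hamming_weight z \<noteq> w) \<and>
        \<not> (\<exists>j<?\<mu>. (\<Sum>l<m. outer_coeff m ?\<mu> j l * z ! l) = real ?\<mu> - 1 - real j)"
      unfolding Q_ball using hamming_weight_eq_sum[OF z, symmetric] by auto
    also have "\<dots> \<longleftrightarrow> hamming_weight z \<in> ?W"
      unfolding outer_weight_iff[OF z mu(1)] using mu(2) by (auto simp: not_less)
    finally show ?thesis using symmetric_set_mem_iff[OF assms(1) z] by blast
  qed
  ultimately show ?thesis by blast
qed

section \<open>Assembling the block covers\<close>

definition block_hyperplane ::
  "nat \<Rightarrow> (nat \<Rightarrow> nat) \<Rightarrow> nat \<Rightarrow> (nat \<Rightarrow> real) \<times> real \<Rightarrow> real list set" where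
  "block_hyperplane k n i p =
     {x. length x = offset n k \<and> (\<Sum>l<n i. fst p l * block n x i ! l) = snd p}"

lemma affine_hyperplane_block:
  assumes "i < k" "\<exists>l<n i. fst p l \<noteq> 0"
  shows "affine_hyperplane (offset n k) (block_hyperplane k n i p)"
proof -
  define a where "a j = (if j \<in> block_indices n i then fst p (j - offset n i) else 0)" for j
  obtain l where l: "l < n i" "fst p l \<noteq> 0" using assms(2) by blast
  then have "offset n i + l < offset n k" using offset_Suc_le[OF assms(1), of n] by linarith
  moreover have "a (offset n i + l) \<noteq> 0" using l by (simp add: a_def block_indices_def)
  ultimately have nz: "\<exists>j<offset n k. a j \<noteq> 0" by blast
  have "(\<Sum>l<n i. fst p l * block n x i ! l) = (\<Sum>j<offset n k. a j * x ! j)"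
    if "length x = offset n k" for x
  proof -
    have "(\<Sum>j<offset n k. a j * x ! j) = (\<Sum>j\<in>block_indices n i. fst p (j - offset n i) * x ! j)"
      using block_indices_subset[OF assms(1), of n] by (intro sum.mono_neutral_cong_right) (auto simp: a_def)
    also have "\<dots> = (\<Sum>l<n i. fst p l * x ! (l + offset n i))"
      unfolding block_indices_def
      by (rule sum.reindex_bij_witness[of _ "\<lambda>l. l + offset n i" "\<lambda>j. j - offset n i"]) auto
    also have "\<dots> = (\<Sum>l<n i. fst p l * block n x i ! l)"
      using that offset_Suc_le[OF assms(1), of n] by (simp add: block_def add.commute)
    finally show ?thesis by simp
  qed
  then have eq: "block_hyperplane k n i p = {x. length x = offset n k \<and> (\<Sum>j<offset n k. a j * x ! j) = snd p}"
    unfolding block_hyperplane_def by (intro Collect_cong conj_cong) simp_all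
  show ?thesis unfolding affine_hyperplane_def by (intro exI[of _ a] exI[of _ "snd p"] conjI nz eq)
qed

lemma affine_hyperplane_coordinate:
  assumes "0 < N"
  shows "affine_hyperplane N {x. length x = N \<and> x ! 0 = c}"
  unfolding affine_hyperplane_def
proof (intro exI conjI)
  show "{x. length x = N \<and> x ! 0 = c} = {x. length x = N \<and> (\<Sum>i<N. (if i = 0 then 1 else 0) * x ! i) = c}"
    using assms by (auto simp: if_distrib[of "\<lambda>a. a * _"] cong: if_cong)
qed (use assms in auto)

lemma filter_replicate_mset:
  "filter_mset P (replicate_mset n x) = (if P x then replicate_mset n x else {#})"
  by (induction n) auto

text \<open>A point lies on the grid iff it avoids all block hyperplanes. Every point of the cube
  satisfies exactly one of \<open>x ! 0 = 0\<close> and \<open>x ! 0 = 1\<close>, so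
  \<open>l\<close> copies of each raise all counts by exactly \<open>l\<close>.\<close>

lemma EHC_grid_le:
  assumes sym: "\<And>i. i < k \<Longrightarrow> symmetric_set (n i) (S i)" and ne: "grid k S \<noteq> {}"
    and n: "\<And>i. i < k \<Longrightarrow> n i \<ge> 1" and k: "k \<ge> 1"
  shows "EHC (offset n k) (Suc l) l (cube (offset n k) - grid k S) \<le>
    enat ((\<Sum>i<k. Lambda_bar (n i) (S i)) + 2 * l)"
proof -
  let ?N = "offset n k"
  have sub: "S i \<subseteq> cube (n i)" if "i < k" for i using sym[OF that] by (simp add: symmetric_set_def)
  have nei: "S i \<noteq> {}" if "i < k" for i using ne that unfolding grid_eq_empty_iff by blast
  have "\<forall>i\<in>{..<k}. \<exists>Q :: ((nat \<Rightarrow> real) \<times> real) multiset. size Q = Lambda_bar (n i) (S i) \<and>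
    (\<forall>p\<in>#Q. \<exists>l<n i. fst p l \<noteq> 0) \<and>
    (\<forall>z\<in>cube (n i). z \<in> S i \<longleftrightarrow> (\<forall>p\<in>#Q. (\<Sum>l<n i. fst p l * z ! l) \<noteq> snd p))"
    using ex_block_cover[OF sym nei n] by blast
  from bchoice[OF this] obtain Q where Q: "\<forall>i\<in>{..<k}. size (Q i) = Lambda_bar (n i) (S i) \<and>
    (\<forall>p\<in>#Q i. \<exists>l<n i. fst p l \<noteq> 0) \<and>
    (\<forall>z\<in>cube (n i). z \<in> S i \<longleftrightarrow> (\<forall>p\<in>#Q i. (\<Sum>l<n i. fst p l * z ! l) \<noteq> snd p))" ..
  define G where "G = (\<Sum>i<k. image_mset (block_hyperplane k n i) (Q i))"
  define E where "E c = {x :: real list. length x = ?N \<and> x ! 0 = c}" for c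
  define H where "H = G + replicate_mset l (E 0) + replicate_mset l (E 1)"
  have N: "0 < ?N" using n[of 0] k offset_Suc_le[of 0 k n] by simp
  have G_mem: "h \<in># G \<longleftrightarrow> (\<exists>i<k. \<exists>p\<in>#Q i. h = block_hyperplane k n i p)" for h
    unfolding G_def by (auto simp: set_mset_sum)
  have grid: "x \<in> grid k S \<longleftrightarrow> (\<forall>h\<in>#G. x \<notin> h)" if x: "x \<in> cube ?N" for x
  proof -
    have "x \<in> grid k S \<longleftrightarrow> (\<forall>i<k. block n x i \<in> S i)"
      using in_grid_iff[of k S n x] sub x by (simp add: cube_def)
    also have "\<dots> \<longleftrightarrow> (\<forall>i<k. \<forall>p\<in>#Q i. (\<Sum>l<n i. fst p l * block n x i ! l) \<noteq> snd p)"
      using Q block_in_cube[OF x] by simp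
    also have "\<dots> \<longleftrightarrow> (\<forall>i<k. \<forall>p\<in>#Q i. x \<notin> block_hyperplane k n i p)"
      using x by (simp add: block_hyperplane_def cube_def)
    also have "\<dots> \<longleftrightarrow> (\<forall>h\<in>#G. x \<notin> h)"
      unfolding Ball_def G_mem by blast
    finally show ?thesis .
  qed
  have count: "size {#h \<in># H. x \<in> h#} = size {#h \<in># G. x \<in> h#} + l" if x: "x \<in> cube ?N" for x
  proof -
    have "x ! 0 = 0 \<or> x ! 0 = 1" "length x = ?N" using cube_nth[OF x N] x by (auto simp: cube_def)
    then show ?thesis by (auto simp: H_def E_def filter_replicate_mset)
  qed
  have "exact_hyperplane_cover ?N (Suc l) l (cube ?N - grid k S) H"
    unfolding exact_hyperplane_cover_def
  proof (intro conjI ballI)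
    fix h assume "h \<in># H"
    then consider i p where "i < k" "p \<in># Q i" "h = block_hyperplane k n i p" | c where "h = E c"
      unfolding H_def using G_mem by (auto split: if_splits)
    then show "affine_hyperplane ?N h"
    proof cases
      case 1
      then have "\<exists>l<n i. fst p l \<noteq> 0" using Q by blast
      then show ?thesis using 1 affine_hyperplane_block by blast
    next
      case 2
      then show ?thesis using affine_hyperplane_coordinate[OF N] by (simp add: E_def)
    qed
  next
    fix x assume x: "x \<in> cube ?N - grid k S"
    then have "{#h \<in># G. x \<in> h#} \<noteq> {#}" using grid[of x] by auto
    then have "0 < size {#h \<in># G. x \<in> h#}" unfolding nonempty_has_size .
    then show "Suc l \<le> size {#h \<in># H. x \<in> h#}" using count[of x] x by auto
  next
    fix x assume "x \<in> cube ?N - (cube ?N - grid k S)"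
    then have x: "x \<in> cube ?N" "x \<in> grid k S" by auto
    then have "{#h \<in># G. x \<in> h#} = {#}" using grid[of x] by auto
    then show "size {#h \<in># H. x \<in> h#} = l" using count[OF x(1)] by simp
  qed
  then have "EHC ?N (Suc l) l (cube ?N - grid k S) \<le> enat (size H)"
    unfolding EHC_def by (intro INF_lower) simp
  also have "size H = (\<Sum>i<k. Lambda_bar (n i) (S i)) + 2 * l"
  proof -
    have "size (\<Sum>i<j. image_mset (block_hyperplane k n i) (Q i)) = (\<Sum>i<j. size (Q i))" for j
      by (induction j) auto
    then have "size G = (\<Sum>i<k. size (Q i))" by (simp add: G_def)
    also have "\<dots> = (\<Sum>i<k. Lambda_bar (n i) (S i))" using Q by simp
    finally show ?thesis by (simp add: H_def)
  qed
  finally show ?thesis .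
qed

theorem theorem1p23:
  fixes k N t :: nat and n :: "nat \<Rightarrow> nat" and S :: "nat \<Rightarrow> real list set"
  assumes "k \<ge> 1"
    and "\<And>i. i < k \<Longrightarrow> n i \<ge> 1"
    and "N = (\<Sum>i<k. n i)"
    and "\<And>i. i < k \<Longrightarrow> symmetric_set (n i) (S i)"
    and "grid k S \<noteq> {}"
    and "t \<ge> 1"
  shows "EHC N t (t - 1) (cube N - grid k S) = EPC N t (t - 1) (cube N - grid k S) \<and>
         EPC N t (t - 1) (cube N - grid k S) =
           enat ((\<Sum>i<k. Lambda_bar (n i) (S i)) + 2 * t - 2)"
proof -
  \<comment> \<open>Writing \<open>t\<close> as a successor removes the truncated subtractions in
    \<open>t - 1\<close> and \<open>2 * t - 2\<close>.\<close>
  obtain l where t: "t = Suc l" using assms(6) by (cases t) auto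
  let ?T = "cube N - grid k S" and ?v = "(\<Sum>i<k. Lambda_bar (n i) (S i)) + 2 * l"
  have "S i \<subseteq> cube (n i)" if "i < k" for i using assms(4)[OF that] by (simp add: symmetric_set_def)
  then have "grid k S \<subseteq> cube N" using grid_subset_cube[of k S n] assms(3) by blast
  then have a: "EPC N (Suc l) l ?T \<le> EHC N (Suc l) l ?T"
    using assms(5) by (intro EPC_le_EHC) blast
  have b: "enat ?v \<le> EPC N (Suc l) l ?T"
    unfolding assms(3) by (rule EPC_grid_ge) (use assms in auto)
  have c: "EHC N (Suc l) l ?T \<le> enat ?v"
    unfolding assms(3) by (rule EHC_grid_le) (use assms in auto)
  have "EHC N (Suc l) l ?T = enat ?v" using c order_trans[OF b a] by (rule antisym)
  moreover have "EPC N (Suc l) l ?T = enat ?v" using order_trans[OF a c] b by (rule antisym)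
  ultimately show ?thesis by (simp add: t)
qed

end
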